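(* Let $T$ be a regular finite tournament with $m\ge 1$ arcs. Suppose $W$ is a tournamenton with $0<\alpha\le W\le 1$ almost everywhere and put $M:=\log(1/\alpha)$. Then $$\|W-1/2\|_2^2\le\left(8\cosh^2 M+\frac M8\right)\left(\frac{(2e^{mM}+m^2M^2)M}{m}\,\Delta_T(W)\right)^{1/2}.$$
   Context: A finite tournament $T=(V,A)$ is an orientation of a complete graph on a finite vertex set; it is regular if every vertex has equal indegree and outdegree. A tournamenton is a measurable function $W\colon[0,1]^2\to[0,1]$ with $W(x,y)+W(y,x)=1$ for almost every $(x,y)$. Integrals are with respect to Lebesgue measure; $\|\cdot\|_2$ is the $L^2$ norm on $[0,1]^2$. Define $$t(T,W):=\int_{[0,1]^V}\prod_{(i,j)\in A}W(x_i,x_j)\prod_{i\in V}dx_i.$$ For an arc $b=(i,j)\in A$, the arc-rooted density $r_b^W(x,y)$ is obtained from the same integrand by fixing $x_i=x$, $x_j=y$ and integrating the remaining vertex variables. When $t(T,W)>0$ (which holds here since $W\ge\alpha>0$), put $q_b^W:=r_b^W/t(T,W)$ and $$\Delta_T(W):=\sum_{b\in A}\|q_b^W-1\|_{L^1([0,1]^2)}.$$ *)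

theory Defs
  imports "HOL-Analysis.Analysis" "Graph_Theory.Pair_Digraph"
begin

text \<open>
  Measurability and integration on the unit square and on the cubes are in the sense of Lebesgue,
  i.e. with respect to complete measures; Borel measurable kernels are thus a special case.
\<close>

locale finite_tournament = pair_digraph +
  assumes one_orientation:
    "\<lbrakk>u \<in> pverts G; v \<in> pverts G; u \<noteq> v\<rbrakk> \<Longrightarrow> (u, v) \<in> parcs G \<longleftrightarrow> (v, u) \<notin> parcs G"

locale regular_tournament = finite_tournament +
  assumes in_degree_eq_out_degree:
    "v \<in> pverts G \<Longrightarrow> in_degree (with_proj G) v = out_degree (with_proj G) v"

definition unit_square :: "(real \<times> real) measure" where
  "unit_square = lebesgue_on ({0..1} \<times> {0..1})"

text \<open>
  The completion is needed: for a Lebesgue measurable kernel \<open>W\<close>, the map \<open>\<lambda>z. W (z i) (z j)\<close> is in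
  general not measurable with respect to the product sigma-algebra itself.
\<close>

definition unit_cube :: "'v set \<Rightarrow> ('v \<Rightarrow> real) measure" where
  "unit_cube V = completion (\<Pi>\<^sub>M v\<in>V. lebesgue_on {0..1})"

definition L1_norm_square :: "(real \<Rightarrow> real \<Rightarrow> real) \<Rightarrow> real" where
  "L1_norm_square f = (LINT (x, y)|unit_square. \<bar>f x y\<bar>)"

definition L2_norm_square :: "(real \<Rightarrow> real \<Rightarrow> real) \<Rightarrow> real" where
  "L2_norm_square f = sqrt (LINT (x, y)|unit_square. (f x y)\<^sup>2)"

definition tournamenton :: "(real \<Rightarrow> real \<Rightarrow> real) \<Rightarrow> bool" where
  "tournamenton W \<longleftrightarrow>
     (\<lambda>(x, y). W x y) \<in> borel_measurable unit_square \<and>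
     (\<forall>x\<in>{0..1}. \<forall>y\<in>{0..1}. W x y \<in> {0..1}) \<and>
     (AE (x, y) in unit_square. W x y + W y x = 1)"

definition arc_product ::
    "'v pair_pre_digraph \<Rightarrow> (real \<Rightarrow> real \<Rightarrow> real) \<Rightarrow> ('v \<Rightarrow> real) \<Rightarrow> real" where
  "arc_product T W z = (\<Prod>(i, j)\<in>parcs T. W (z i) (z j))"

definition hom_density :: "'v pair_pre_digraph \<Rightarrow> (real \<Rightarrow> real \<Rightarrow> real) \<Rightarrow> real" where
  "hom_density T W = (LINT z|unit_cube (pverts T). arc_product T W z)"

text \<open>The product in the arc-rooted density retains the factor \<open>W x y\<close> of the root arc.\<close>

definition arc_rooted_density ::
    "'v pair_pre_digraph \<Rightarrow> (real \<Rightarrow> real \<Rightarrow> real) \<Rightarrow> 'v \<times> 'v \<Rightarrow> real \<Rightarrow> real \<Rightarrow> real" where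
  "arc_rooted_density T W b x y =
     (LINT z|unit_cube (pverts T - {fst b, snd b}). arc_product T W (z(fst b := x, snd b := y)))"

definition normalized_rooted_density ::
    "'v pair_pre_digraph \<Rightarrow> (real \<Rightarrow> real \<Rightarrow> real) \<Rightarrow> 'v \<times> 'v \<Rightarrow> real \<Rightarrow> real \<Rightarrow> real" where
  "normalized_rooted_density T W b x y = arc_rooted_density T W b x y / hom_density T W"

definition rooted_discrepancy :: "'v pair_pre_digraph \<Rightarrow> (real \<Rightarrow> real \<Rightarrow> real) \<Rightarrow> real" where
  "rooted_discrepancy T W =
     (\<Sum>b\<in>parcs T. L1_norm_square (\<lambda>x y. normalized_rooted_density T W b x y - 1))"

end

theory Submission
  imports Defs "HOL-Probability.Infinite_Product_Measure"
begin

text \<open>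
  Let \<open>h = ln W\<close> and choose the labels of the vertices independently and uniformly. The product of
  \<open>W\<close> over all arcs, divided by its mean, is the density \<open>exp L\<close> of a Gibbs measure, and its
  two-dimensional marginals on the arcs are the normalized rooted densities. The sum of the two
  relative entropies between the Gibbs measure and the uniform measure is the integral of
  \<open>(exp L - 1) * L\<close>. As \<open>L\<close> is a sum over arcs up to a constant, this divergence depends only on the
  arc marginals and is at most \<open>M\<close> times the rooted discrepancy (\<open>jeffreys_divergence_le\<close>). On the other
  hand it bounds the second moment of \<open>L\<close> up to the factor \<open>1 + m * M\<close>, because \<open>\<bar>L\<bar> \<le> m * M\<close>
  (\<open>integral_log_gibbs_density_sq_le\<close>).

  A small second moment of \<open>L\<close> makes every component of \<open>L\<close> small. Decompose \<open>h x y\<close> into its mean, a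
  function of \<open>x\<close>, a function of \<open>y\<close>, and an interaction that has mean zero in each variable. The
  interaction of an arc is an orthogonal projection of \<open>L\<close>; and since each vertex has as many incoming
  as outgoing arcs, so is, up to the degree, the sum of the two one-variable functions at a vertex,
  the main effect. Both are therefore small in \<open>L\<^sup>1\<close>
  (\<open>integral_abs_interaction_le\<close>, \<open>integral_abs_main_effect_le\<close>).

  Now \<open>W x y + W y x = 1\<close> enters. The symmetric part \<open>ln (W x y) + ln (W y x)\<close> of \<open>h\<close> involves only main
  effects and interactions, so it is nearly constant: the absolute value of the log-odds
  \<open>u x y = ln (W x y) - ln (W y x)\<close> nearly has a constant value. In the cyclic sum
  \<open>u x y + u y z + u z x\<close> all one-variable functions cancel and only interactions remain, so it is nearly
  zero. Three reals of the same absolute value with sum zero vanish, hence the constant is nearly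
  zero and \<open>W\<close> is near \<open>1/2\<close>. The quantitative form (\<open>mean_log_cosh_le\<close>) measures the log-odds by
  \<open>2 * ln (cosh (u / 2))\<close>, which equals minus the symmetric part up to the constant \<open>ln 4\<close> and is
  superadditive on reals of equal sign.

  This argument takes place over an arbitrary probability space, for a kernel with pointwise bounds,
  and yields the factor \<open>9/2\<close>, which is less than \<open>8 * (cosh M)\<^sup>2 + M / 8\<close>. A tournamenton is replaced by such a
  kernel up to a null set, which changes neither the densities nor the norms.
\<close>

section \<open>Elementary inequalities\<close>

text \<open>
  Both factors of \<open>(exp x - 1) * x\<close> have the same sign, and \<open>\<bar>exp x - 1\<bar> \<ge> \<bar>x\<bar> / (1 + \<bar>x\<bar>)\<close> by
  \<open>exp y \<ge> 1 + y\<close>, applied to \<open>y = x\<close> for positive and to \<open>y = - x\<close> for negative \<open>x\<close>. The factor is only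
  linear in \<open>R\<close>; this is what leaves room for the number of arcs in the final constant.
\<close>

lemma square_le_exp_minus_one_mult:
  fixes x R :: real
  assumes "\<bar>x\<bar> \<le> R"
  shows "x\<^sup>2 \<le> (1 + R) * ((exp x - 1) * x)"
proof (cases "x \<ge> 0")
  case True
  have "x * x \<le> (exp x - 1) * x"
    using exp_ge_add_one_self[of x] True by (intro mult_right_mono) linarith+
  also have "\<dots> \<le> (1 + R) * ((exp x - 1) * x)"
    using True assms by (auto intro!: mult_right_mono[of 1 "1 + R", simplified] mult_nonneg_nonneg)
  finally show ?thesis by (simp add: power2_eq_square)
next
  case False
  have R: "-x \<le> R" "0 \<le> R" using assms by auto
  have "(1 - x) * exp x \<le> exp (-x) * exp x"
    using exp_ge_add_one_self[of "-x"] by (intro mult_right_mono) auto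
  hence 1: "(1 - x) * exp x \<le> 1" by (simp add: exp_minus)
  hence "- x \<le> (1 - x) * (1 - exp x)" by (simp add: algebra_simps)
  also have "\<dots> \<le> (1 + R) * (1 - exp x)"
    using R False by (intro mult_right_mono) auto
  finally have "(-x) * (-x) \<le> ((1 + R) * (1 - exp x)) * (-x)"
    using False by (intro mult_right_mono) auto
  thus ?thesis by (simp add: power2_eq_square algebra_simps)
qed

text \<open>
  If \<open>u\<close> is the log-odds of a probability \<open>w\<close>, then this is \<open>- ln (4 * w * (1 - w))\<close>, a measure of the
  distance of \<open>w\<close> from \<open>1/2\<close>. The factors \<open>2\<close> and \<open>1/2\<close> make the function 1-Lipschitz in \<open>u\<close>.
\<close>

definition log_cosh :: "real \<Rightarrow> real" where
  "log_cosh u = 2 * ln (cosh (u / 2))"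

lemma log_cosh_minus [simp]: "log_cosh (- u) = log_cosh u"
  by (simp add: log_cosh_def)

lemma log_cosh_superadditive:
  assumes "u * v \<ge> 0"
  shows "log_cosh u + log_cosh v \<le> log_cosh (u + v)"
proof -
  have "sinh (u / 2) * sinh (v / 2) \<ge> 0"
    using assms by (auto simp: zero_le_mult_iff)
  hence "cosh (u / 2) * cosh (v / 2) \<le> cosh (u / 2 + v / 2)"
    by (simp add: cosh_add)
  hence "ln (cosh (u / 2) * cosh (v / 2)) \<le> ln (cosh (u / 2 + v / 2))"
    by (subst ln_le_cancel_iff) (auto intro!: mult_pos_pos cosh_real_pos)
  thus ?thesis
    by (simp add: log_cosh_def ln_mult_pos cosh_real_pos add_divide_distrib)
qed

lemma log_cosh_add_le: "log_cosh (u + v) \<le> log_cosh u + \<bar>v\<bar>"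
proof -
  have "cosh (u / 2 + v / 2) \<le> exp (\<bar>v\<bar> / 2) * cosh (u / 2)"
  proof -
    have "exp (u / 2) * exp (v / 2) + exp (- u / 2) * exp (- v / 2)
        \<le> exp (u / 2) * exp (\<bar>v\<bar> / 2) + exp (- u / 2) * exp (\<bar>v\<bar> / 2)"
      by (intro add_mono mult_left_mono) auto
    hence "exp (u / 2 + v / 2) + exp (- (u / 2 + v / 2))
        \<le> exp (\<bar>v\<bar> / 2) * (exp (u / 2) + exp (- (u / 2)))"
      by (simp add: distrib_left exp_add[symmetric] add.commute)
    thus ?thesis
      by (simp add: cosh_def)
  qed
  hence "ln (cosh (u / 2 + v / 2)) \<le> ln (exp (\<bar>v\<bar> / 2) * cosh (u / 2))"
    by (subst ln_le_cancel_iff) (auto intro!: mult_pos_pos cosh_real_pos)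
  thus ?thesis
    by (simp add: log_cosh_def ln_mult_pos cosh_real_pos add_divide_distrib)
qed

text \<open>
  Among three reals two have the same sign, say \<open>u\<close> and \<open>v\<close>. If \<open>u + v + w\<close> vanishes, then
  superadditivity gives \<open>log_cosh u + log_cosh v \<le> log_cosh w\<close>, which for three values equal to \<open>q\<close> reads
  \<open>2 * q \<le> q\<close>, so that \<open>q \<le> 0\<close>. The right-hand side collects the errors if this holds approximately.
\<close>

lemma log_cosh_cyclic:
  fixes q :: real
  shows "q \<le> \<bar>u + v + w\<bar> + \<bar>log_cosh u - q\<bar> + \<bar>log_cosh v - q\<bar> + \<bar>log_cosh w - q\<bar>"
proof -
  \<comment> \<open>The Lipschitz bound replaces \<open>u + v\<close> by \<open>- w\<close>, and \<open>log_cosh\<close> is even.\<close>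
  have *: "q \<le> \<bar>u + v + w\<bar> + \<bar>log_cosh u - q\<bar> + \<bar>log_cosh v - q\<bar> + \<bar>log_cosh w - q\<bar>"
    if "u * v \<ge> 0" for u v w
  proof -
    have "log_cosh u + log_cosh v \<le> log_cosh (- w + (u + v + w))"
      using log_cosh_superadditive[OF that] by simp
    also have "\<dots> \<le> log_cosh w + \<bar>u + v + w\<bar>"
      using log_cosh_add_le[of "- w" "u + v + w"] by simp
    finally show ?thesis by linarith
  qed
  consider "u * v \<ge> 0" | "u * w \<ge> 0" | "v * w \<ge> 0"
    by (metis linorder_linear mult_nonneg_nonneg mult_nonpos_nonpos)
  thus ?thesis
    using *[of u v w] *[of u w v] *[of v w u] by cases (simp_all add: algebra_simps)
qed

lemma log_cosh_ln_odds:
  fixes w :: real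
  assumes "0 < w" "w < 1"
  shows "log_cosh (ln w - ln (1 - w)) = - (ln 4 + ln w + ln (1 - w))"
proof -
  let ?u = "ln w - ln (1 - w)"
  have "exp (?u / 2) * exp (?u / 2) = w / (1 - w)"
    using assms by (simp add: exp_add[symmetric] exp_diff)
  moreover have e: "exp (- (?u / 2)) * exp (- (?u / 2)) = (1 - w) / w"
    using assms by (simp add: exp_add[symmetric] exp_diff flip: minus_divide_left)
  moreover have "exp (?u / 2) * exp (- (?u / 2)) = 1" by (simp add: exp_minus)
  moreover have "4 * (cosh (?u / 2))\<^sup>2 = exp (?u / 2) * exp (?u / 2)
      + exp (- (?u / 2)) * exp (- (?u / 2)) + 2 * (exp (?u / 2) * exp (- (?u / 2)))"
    unfolding cosh_def power2_eq_square by (simp add: field_simps)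
  ultimately have "4 * (cosh (?u / 2))\<^sup>2 = w / (1 - w) + (1 - w) / w + 2"
    by (simp only:)
  also have "\<dots> = 1 / (w * (1 - w))"
    using assms by (simp add: divide_simps) (simp add: algebra_simps)
  finally have "(cosh (?u / 2))\<^sup>2 = 1 / (w * (1 - w)) / 4"
    by (metis nonzero_mult_div_cancel_left zero_neq_numeral)
  hence "(cosh (?u / 2))\<^sup>2 = 1 / (4 * w * (1 - w))" by (simp add: mult.assoc)
  hence "ln ((cosh (?u / 2))\<^sup>2) = - (ln 4 + ln w + ln (1 - w))"
    using assms by (simp add: ln_div ln_mult_pos)
  thus ?thesis
    by (simp add: log_cosh_def ln_realpow cosh_real_pos)
qed

lemma square_minus_half_le_ln:
  fixes w :: real
  assumes "0 < w" "w < 1"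
  shows "(w - 1 / 2)\<^sup>2 \<le> - (ln 4 + ln w + ln (1 - w)) / 4"
proof -
  have "ln 4 + ln w + ln (1 - w) = ln (4 * w * (1 - w))"
    using assms by (simp add: ln_mult_pos)
  also have "\<dots> \<le> 4 * w * (1 - w) - 1"
    using assms by (intro ln_le_minus_one) simp
  also have "\<dots> = - 4 * (w - 1 / 2)\<^sup>2"
    by (simp add: power2_eq_square algebra_simps)
  finally show ?thesis by simp
qed

section \<open>Integration over powers of a probability space\<close>

lemma update_pair_in_PiE_iff:
  assumes "i \<in> I" "j \<in> I" "i \<noteq> j" "z \<in> extensional (I - {i, j})"
  shows "z(i := x, j := y) \<in> Pi\<^sub>E I A \<longleftrightarrow> x \<in> A i \<and> y \<in> A j \<and> z \<in> Pi\<^sub>E (I - {i, j}) A"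
proof -
  have *: "(\<forall>n\<in>I. u n \<in> A n) \<longleftrightarrow> u i \<in> A i \<and> u j \<in> A j \<and> (\<forall>n\<in>I - {i, j}. u n \<in> A n)" for u
    using assms(1,2) by blast
  have "z(i := x, j := y) \<in> extensional I"
    using assms by (simp add: extensional_def)
  thus ?thesis
    using assms(3,4) *[of "z(i := x, j := y)"] by (simp add: PiE_iff)
qed

context prob_space
begin

lemma abs_integral_le:
  fixes f :: "'a \<Rightarrow> real"
  assumes "\<And>x. x \<in> space M \<Longrightarrow> \<bar>f x\<bar> \<le> C"
  shows "\<bar>\<integral>x. f x \<partial>M\<bar> \<le> C"
proof -
  have "0 \<le> C" using assms not_empty by force
  show ?thesis
  proof (cases "integrable M f")
    case True
    have "\<bar>\<integral>x. f x \<partial>M\<bar> \<le> (\<integral>x. \<bar>f x\<bar> \<partial>M)" by (rule integral_abs_bound)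
    also have "\<dots> \<le> (\<integral>x. C \<partial>M)" using True assms by (intro integral_mono) auto
    finally show ?thesis by (simp add: prob_space)
  qed (simp add: not_integrable_integral_eq \<open>0 \<le> C\<close>)
qed

lemma integrable_bounded:
  fixes f :: "'a \<Rightarrow> real"
  assumes "f \<in> borel_measurable M" "\<And>x. x \<in> space M \<Longrightarrow> \<bar>f x\<bar> \<le> C"
  shows "integrable M f"
  using assms by (intro integrable_const_bound[where B = C]) auto

lemma integrable_bounded_sq:
  fixes f :: "'a \<Rightarrow> real"
  assumes "f \<in> borel_measurable M" "\<And>x. x \<in> space M \<Longrightarrow> \<bar>f x\<bar> \<le> C"
  shows "integrable M (\<lambda>x. (f x)\<^sup>2)"
proof (rule integrable_bounded)
  fix x assume "x \<in> space M"
  thus "\<bar>(f x)\<^sup>2\<bar> \<le> C\<^sup>2"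
    using assms(2)[of x] power_mono[of "\<bar>f x\<bar>" C 2] by simp
qed (use assms in measurable)

lemma integral_abs_le_sqrt:
  fixes f :: "'a \<Rightarrow> real"
  assumes "integrable M f" "integrable M (\<lambda>x. (f x)\<^sup>2)"
  shows "(\<integral>x. \<bar>f x\<bar> \<partial>M) \<le> sqrt (\<integral>x. (f x)\<^sup>2 \<partial>M)"
proof (rule real_le_rsqrt)
  have "0 \<le> variance (\<lambda>x. \<bar>f x\<bar>)" by (rule variance_positive)
  thus "(\<integral>x. \<bar>f x\<bar> \<partial>M)\<^sup>2 \<le> (\<integral>x. (f x)\<^sup>2 \<partial>M)"
    using assms by (subst (asm) variance_eq) auto
qed

abbreviation power_space :: "'v set \<Rightarrow> ('v \<Rightarrow> 'a) measure" where
  "power_space I \<equiv> Pi\<^sub>M I (\<lambda>_. M)"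

lemma product_prob_space_const: "product_prob_space (\<lambda>_. M)"
  by unfold_locales

lemma prob_space_power_space: "prob_space (power_space I)"
  by (rule prob_space_PiM) unfold_locales

text \<open>
  Fubini for a single coordinate. All orthogonality relations below are instances: one coordinate
  occurs only in a factor whose integral over that coordinate vanishes.
\<close>

lemma integral_power_space_slice_zero:
  fixes f :: "('v \<Rightarrow> 'a) \<Rightarrow> real"
  assumes "finite I" "i \<in> I" "integrable (power_space I) f"
    and zero: "\<And>z. (\<And>j. j \<in> I - {i} \<Longrightarrow> z j \<in> space M) \<Longrightarrow> (\<integral>x. f (z(i := x)) \<partial>M) = 0"
  shows "(\<integral>z. f z \<partial>power_space I) = 0"
proof -
  interpret Q: product_prob_space "\<lambda>_::'v. M" by (rule product_prob_space_const)
  have I: "insert i (I - {i}) = I" using assms by auto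
  have "(\<integral>z. f z \<partial>power_space I) = (\<integral>z. f z \<partial>power_space (insert i (I - {i})))"
    by (simp only: I)
  also have "\<dots> = (\<integral>z. (\<integral>x. f (z(i := x)) \<partial>M) \<partial>power_space (I - {i}))"
    using assms by (subst Q.product_integral_insert) (simp_all only: I, simp_all)
  also have "\<dots> = (\<integral>z. 0 \<partial>power_space (I - {i}))"
    by (intro Bochner_Integration.integral_cong refl zero) (auto simp: space_PiM PiE_iff)
  finally show ?thesis by simp
qed

lemma distr_power_space_pair:
  assumes "i \<in> I" "j \<in> I" "i \<noteq> j"
  shows "distr (power_space I) (M \<Otimes>\<^sub>M M) (\<lambda>z. (z i, z j)) = M \<Otimes>\<^sub>M M"
proof (rule pair_measure_eqI[symmetric])
  fix A B assume AB: "A \<in> sets M" "B \<in> sets M"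
  let ?X = "\<lambda>n. if n = i then A else B"
  have eq: "(\<lambda>z. (z i, z j)) -` (A \<times> B) \<inter> space (power_space I)
      = prod_emb I (\<lambda>_. M) {i, j} (Pi\<^sub>E {i, j} ?X)"
    using assms AB[THEN sets.sets_into_space]
    by (auto simp: prod_emb_def space_PiM PiE_iff extensional_def restrict_def)
  have "emeasure (distr (power_space I) (M \<Otimes>\<^sub>M M) (\<lambda>z. (z i, z j))) (A \<times> B)
      = emeasure (power_space I) (prod_emb I (\<lambda>_. M) {i, j} (Pi\<^sub>E {i, j} ?X))"
    using assms AB by (subst emeasure_distr) (auto simp: eq)
  also have "\<dots> = (\<Prod>n\<in>{i, j}. emeasure M (?X n))"
    using assms AB by (intro emeasure_PiM_emb) (auto intro: prob_space_axioms)
  also have "\<dots> = emeasure M A * emeasure M B"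
    using assms by simp
  finally show "emeasure M A * emeasure M B
      = emeasure (distr (power_space I) (M \<Otimes>\<^sub>M M) (\<lambda>z. (z i, z j))) (A \<times> B)" by simp
qed (use sigma_finite_measure_axioms in auto)

lemma integral_power_space_pair:
  fixes g :: "'a \<Rightarrow> 'a \<Rightarrow> real"
  assumes "i \<in> I" "j \<in> I" "i \<noteq> j" "case_prod g \<in> borel_measurable (M \<Otimes>\<^sub>M M)"
  shows "(\<integral>z. g (z i) (z j) \<partial>power_space I) = (\<integral>(x, y). g x y \<partial>(M \<Otimes>\<^sub>M M))"
proof -
  have "(\<integral>(x, y). g x y \<partial>(M \<Otimes>\<^sub>M M)) = (\<integral>(x, y). g x y \<partial>distr (power_space I) (M \<Otimes>\<^sub>M M) (\<lambda>z. (z i, z j)))"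
    using assms by (simp add: distr_power_space_pair)
  also have "\<dots> = (\<integral>z. g (z i) (z j) \<partial>power_space I)"
    using assms by (subst integral_distr) auto
  finally show ?thesis by simp
qed

lemma integral_power_space_single:
  fixes g :: "'a \<Rightarrow> real"
  assumes "i \<in> I" "g \<in> borel_measurable M"
  shows "(\<integral>z. g (z i) \<partial>power_space I) = (\<integral>x. g x \<partial>M)"
proof -
  interpret Q: product_prob_space "\<lambda>_::'b. M" by (rule product_prob_space_const)
  have "(\<integral>x. g x \<partial>M) = (\<integral>x. g x \<partial>distr (power_space I) M (\<lambda>z. z i))"
    using assms by (simp add: Q.PiM_component)
  also have "\<dots> = (\<integral>z. g (z i) \<partial>power_space I)"
    using assms by (subst integral_distr) auto
  finally show ?thesis by simp
qed

lemma measurable_update_pair: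
  assumes "i \<in> I" "j \<in> I" "i \<noteq> j"
  shows "(\<lambda>p. (snd p)(i := fst (fst p), j := snd (fst p)))
    \<in> (M \<Otimes>\<^sub>M M) \<Otimes>\<^sub>M power_space (I - {i, j}) \<rightarrow>\<^sub>M power_space I" (is "?u \<in> ?N \<rightarrow>\<^sub>M _")
proof -
  have comp: "(\<lambda>p. ?u p n) \<in> ?N \<rightarrow>\<^sub>M M" if n: "n \<in> I" for n
  proof -
    consider "n = j" | "n = i" | "n \<in> I - {i, j}" using n by blast
    thus ?thesis using assms by cases auto
  qed
  moreover have "?u \<in> space ?N \<rightarrow> (\<Pi>\<^sub>E n\<in>I. space M)"
  proof
    fix p :: "('a \<times> 'a) \<times> ('b \<Rightarrow> 'a)" assume p: "p \<in> space ?N"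
    hence "snd p \<in> extensional (I - {i, j})"
      unfolding space_pair_measure space_PiM by (simp add: mem_Times_iff PiE_iff)
    thus "?u p \<in> (\<Pi>\<^sub>E n\<in>I. space M)"
      using p assms by (subst update_pair_in_PiE_iff) (simp_all add: space_pair_measure space_PiM mem_Times_iff)
  qed
  ultimately show ?thesis by (intro measurable_PiM_single')
qed

text \<open>
  The coordinates \<open>i\<close> and \<open>j\<close> are independent of all the others, so a random point may be drawn by
  choosing these two separately. The measures agree on boxes.
\<close>

lemma distr_update_pair:
  fixes I :: "'v set"
  assumes "finite I" "i \<in> I" "j \<in> I" "i \<noteq> j"
  shows "distr ((M \<Otimes>\<^sub>M M) \<Otimes>\<^sub>M power_space (I - {i, j})) (power_space I)
      (\<lambda>p. (snd p)(i := fst (fst p), j := snd (fst p))) = power_space I"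
proof -
  let ?J = "I - {i, j}"
  let ?N = "(M \<Otimes>\<^sub>M M) \<Otimes>\<^sub>M power_space ?J"
  let ?u = "\<lambda>p. (snd p)(i := fst (fst p), j := snd (fst p))"
  interpret Q: product_prob_space "\<lambda>_::'v. M" by (rule product_prob_space_const)
  interpret R: prob_space "power_space ?J" by (rule prob_space_power_space)
  note upd = measurable_update_pair[OF assms(2-4)]
  show ?thesis
  proof (rule Q.PiM_eqI)
    fix A assume A: "\<And>n. n \<in> I \<Longrightarrow> A n \<in> sets M"
    have eq: "?u -` (Pi\<^sub>E I A) \<inter> space ?N = (A i \<times> A j) \<times> (Pi\<^sub>E ?J A)"
    proof (rule set_eqI)
      fix p :: "('a \<times> 'a) \<times> ('v \<Rightarrow> 'a)"
      obtain x y z where p: "p = ((x, y), z)" by (metis prod.exhaust)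
      have A': "A n \<subseteq> space M" if "n \<in> I" for n
        using that A sets.sets_into_space by blast
      have Pi: "Pi\<^sub>E ?J A \<subseteq> space (power_space ?J)"
        unfolding space_PiM using A' by (intro PiE_mono) blast
      have ext: "z \<in> extensional ?J" if "z \<in> space (power_space ?J)"
        using that unfolding space_PiM by (simp add: PiE_iff)
      have "p \<in> ?u -` (Pi\<^sub>E I A) \<inter> space ?N
          \<longleftrightarrow> z(i := x, j := y) \<in> Pi\<^sub>E I A \<and> x \<in> space M \<and> y \<in> space M \<and> z \<in> space (power_space ?J)"
        by (simp only: p vimage_eq Int_iff space_pair_measure mem_Times_iff fst_conv snd_conv conj_assoc)
      also have "\<dots> \<longleftrightarrow> x \<in> A i \<and> y \<in> A j \<and> z \<in> Pi\<^sub>E ?J A"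
      proof (cases "z \<in> space (power_space ?J)")
        case True
        show ?thesis
          using True subsetD[OF A'[OF assms(2)], of x] subsetD[OF A'[OF assms(3)], of y]
          by (simp only: update_pair_in_PiE_iff[OF assms(2-4) ext[OF True], of x y A]) (simp only: simp_thms conj_assoc, argo)
      next
        case False
        thus ?thesis using subsetD[OF Pi, of z] by argo
      qed
      also have "\<dots> \<longleftrightarrow> p \<in> (A i \<times> A j) \<times> (Pi\<^sub>E ?J A)"
        by (simp only: p mem_Times_iff fst_conv snd_conv conj_assoc)
      finally show "p \<in> ?u -` (Pi\<^sub>E I A) \<inter> space ?N \<longleftrightarrow> p \<in> (A i \<times> A j) \<times> (Pi\<^sub>E ?J A)" .
    qed
    have "emeasure (distr ?N (power_space I) ?u) (Pi\<^sub>E I A)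
        = emeasure ?N ((A i \<times> A j) \<times> (Pi\<^sub>E ?J A))"
      using assms(1) A by (subst emeasure_distr[OF upd]) (simp_all only: eq sets_PiM_I_finite)
    also have "\<dots> = emeasure M (A i) * emeasure M (A j) * (\<Prod>n\<in>?J. emeasure M (A n))"
    proof -
      have J: "finite ?J" "\<And>n. n \<in> ?J \<Longrightarrow> A n \<in> sets M" using assms(1) A by simp_all
      have "A i \<in> sets M" "A j \<in> sets M" using A assms(2,3) by simp_all
      thus ?thesis
        by (simp only: R.emeasure_pair_measure_Times emeasure_pair_measure_Times pair_measureI
            sets_PiM_I_finite[OF J] Q.emeasure_PiM[OF J])
    qed
    also have "\<dots> = (\<Prod>n\<in>insert i (insert j ?J). emeasure M (A n))"
      using assms by (simp add: mult.assoc)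
    also have "insert i (insert j ?J) = I" using assms by auto
    finally show "emeasure (distr ?N (power_space I) ?u) (Pi\<^sub>E I A) = (\<Prod>n\<in>I. emeasure M (A n))" .
  qed (simp_all add: assms(1))
qed

lemma integral_power_space_disintegrate:
  fixes f :: "('v \<Rightarrow> 'a) \<Rightarrow> real"
  assumes "finite I" "i \<in> I" "j \<in> I" "i \<noteq> j"
    and [measurable]: "f \<in> borel_measurable (power_space I)"
    and bounded: "\<And>z. z \<in> space (power_space I) \<Longrightarrow> \<bar>f z\<bar> \<le> C"
  shows "(\<integral>z. f z \<partial>power_space I)
    = (\<integral>(x, y). (\<integral>z. f (z(i := x, j := y)) \<partial>power_space (I - {i, j})) \<partial>(M \<Otimes>\<^sub>M M))"
proof -
  let ?J = "I - {i, j}"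
  let ?N = "(M \<Otimes>\<^sub>M M) \<Otimes>\<^sub>M power_space ?J"
  let ?u = "\<lambda>p. (snd p)(i := fst (fst p), j := snd (fst p))"
  interpret R: prob_space "power_space ?J" by (rule prob_space_power_space)
  interpret MM: pair_prob_space M M ..
  interpret MMR: pair_prob_space "M \<Otimes>\<^sub>M M" "power_space ?J" ..
  have upd [measurable]: "?u \<in> ?N \<rightarrow>\<^sub>M power_space I"
    using assms(2-4) by (rule measurable_update_pair)
  have distr: "distr ?N (power_space I) ?u = power_space I"
    using assms(1-4) by (rule distr_update_pair)
  have "(\<integral>z. f z \<partial>power_space I) = (\<integral>z. f z \<partial>distr ?N (power_space I) ?u)"
    by (simp only: distr)
  also have "\<dots> = (\<integral>p. f (?u p) \<partial>?N)" using upd assms(5) by (rule integral_distr)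
  also have "\<dots> = (\<integral>q. (\<integral>z. f (?u (q, z)) \<partial>power_space ?J) \<partial>(M \<Otimes>\<^sub>M M))"
  proof (rule MMR.integral_fst'[symmetric])
    show "integrable ?N (\<lambda>p. f (?u p))"
    proof (rule MMR.P.integrable_bounded)
      show "(\<lambda>p. f (?u p)) \<in> borel_measurable ?N"
        using upd assms(5) by (rule measurable_compose)
      show "\<bar>f (?u p)\<bar> \<le> C" if "p \<in> space ?N" for p
        using bounded[OF measurable_space[OF upd that]] .
    qed
  qed
  finally show ?thesis by (simp only: case_prod_unfold fst_conv snd_conv)
qed

end

section \<open>Gibbs measures of pair potentials on an oriented graph\<close>

text \<open>
  A potential \<open>h\<close> on the arcs of an oriented graph defines a Gibbs measure on the vertex labellings,
  with density \<open>exp energy / partition_fn\<close> relative to the product measure \<open>P\<close>. For \<open>h = ln W\<close> the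
  normalizing constant is the density of the graph in the kernel \<open>W\<close>, and the two-dimensional marginal
  densities of the Gibbs measure are the normalized arc-rooted densities. Antisymmetry of \<open>E\<close> excludes
  loops as well.
\<close>

locale pair_potential = prob_space M for M :: "'a measure" +
  fixes V :: "'v set" and E :: "('v \<times> 'v) set" and h :: "'a \<Rightarrow> 'a \<Rightarrow> real" and C :: real
  assumes finite_V: "finite V"
    and E_subset: "E \<subseteq> V \<times> V"
    and E_asym: "(i, j) \<in> E \<Longrightarrow> (j, i) \<notin> E"
    and h_measurable: "case_prod h \<in> borel_measurable (M \<Otimes>\<^sub>M M)"
    and h_bounds: "\<And>x y. x \<in> space M \<Longrightarrow> y \<in> space M \<Longrightarrow> h x y \<in> {- C..0}"
begin

abbreviation P :: "('v \<Rightarrow> 'a) measure" where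
  "P \<equiv> power_space V"

sublocale P: prob_space P
  by (rule prob_space_power_space)

lemma finite_E: "finite E"
  using finite_V E_subset finite_subset by blast

lemma arc_in_V: "(i, j) \<in> E \<Longrightarrow> i \<in> V" "(i, j) \<in> E \<Longrightarrow> j \<in> V"
  using E_subset by auto

lemma no_loop: "(i, i) \<notin> E"
  using E_asym by blast

lemma C_nonneg: "0 \<le> C"
  using h_bounds not_empty by force

lemma P_space: "z \<in> space P \<Longrightarrow> i \<in> V \<Longrightarrow> z i \<in> space M"
  by (auto simp: space_PiM)

lemma measurable_pair_coords [measurable (raw)]:
  assumes "i \<in> V" "j \<in> V" "case_prod g \<in> borel_measurable (M \<Otimes>\<^sub>M M)"
  shows "(\<lambda>z. g (z i) (z j)) \<in> borel_measurable P"
  using assms by (intro measurable_Pair_compose_split[of g M M borel]) auto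

lemma measurable_h [measurable (raw)]:
  assumes "f \<in> N \<rightarrow>\<^sub>M M" "g \<in> N \<rightarrow>\<^sub>M M"
  shows "(\<lambda>x. h (f x) (g x)) \<in> borel_measurable N"
  using assms h_measurable by (intro measurable_Pair_compose_split[of h M M borel])

definition energy :: "('v \<Rightarrow> 'a) \<Rightarrow> real" where
  "energy z = (\<Sum>(i, j)\<in>E. h (z i) (z j))"

definition partition_fn :: real where
  "partition_fn = (\<integral>z. exp (energy z) \<partial>P)"

definition log_gibbs_density :: "('v \<Rightarrow> 'a) \<Rightarrow> real" where
  "log_gibbs_density z = energy z - ln partition_fn"

lemma measurable_energy [measurable]: "energy \<in> borel_measurable P"
  unfolding energy_def using arc_in_V by (auto intro!: borel_measurable_sum)

lemma measurable_log_gibbs_density [measurable]: "log_gibbs_density \<in> borel_measurable P"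
  unfolding log_gibbs_density_def by measurable

lemma energy_bounds:
  assumes "z \<in> space P"
  shows "energy z \<in> {- (card E * C)..0}"
proof -
  have "h (z i) (z j) \<in> {- C..0}" if "(i, j) \<in> E" for i j
    using that assms P_space arc_in_V by (intro h_bounds) auto
  hence "(\<Sum>e\<in>E. - C) \<le> energy z" "energy z \<le> (\<Sum>e\<in>E. 0)"
    unfolding energy_def by (intro sum_mono; force)+
  thus ?thesis by simp
qed

lemma integrable_exp_energy: "integrable P (\<lambda>z. exp (energy z))"
  using energy_bounds by (intro P.integrable_bounded[of _ 1]) auto

lemma partition_fn_bounds: "partition_fn \<in> {exp (- (card E * C))..1}"
proof -
  have "(\<integral>z. exp (- (card E * C)) \<partial>P) \<le> partition_fn"
    unfolding partition_fn_def using energy_bounds integrable_exp_energy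
    by (intro integral_mono) auto
  moreover have "partition_fn \<le> (\<integral>z. 1 \<partial>P)"
    unfolding partition_fn_def using energy_bounds integrable_exp_energy
    by (intro integral_mono) auto
  ultimately show ?thesis by (simp add: P.prob_space)
qed

lemma partition_fn_pos: "0 < partition_fn"
  using partition_fn_bounds by (auto intro: less_le_trans[OF exp_gt_zero])

lemma exp_log_gibbs_density: "exp (log_gibbs_density z) = exp (energy z) / partition_fn"
  using partition_fn_pos by (simp add: log_gibbs_density_def exp_diff)

lemma abs_log_gibbs_density_le: "z \<in> space P \<Longrightarrow> \<bar>log_gibbs_density z\<bar> \<le> card E * C"
proof -
  assume "z \<in> space P"
  moreover have "ln (exp (- (card E * C))) \<le> ln partition_fn" "ln partition_fn \<le> 0"
    using partition_fn_bounds partition_fn_pos by (auto simp: ln_ge_iff)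
  ultimately show ?thesis using energy_bounds[of z] by (auto simp: log_gibbs_density_def abs_if)
qed

lemma integrable_log_gibbs_density_sq [simp]: "integrable P (\<lambda>z. (log_gibbs_density z)\<^sup>2)"
  using abs_log_gibbs_density_le by (intro P.integrable_bounded_sq) auto

lemma integral_gibbs: "(\<integral>z. exp (log_gibbs_density z) \<partial>P) = 1"
  using partition_fn_pos by (simp add: exp_log_gibbs_density partition_fn_def)

text \<open>
  The sum of the two relative entropies between the Gibbs measure and \<open>P\<close>.
\<close>

definition jeffreys_divergence :: real where
  "jeffreys_divergence = (\<integral>z. (exp (log_gibbs_density z) - 1) * log_gibbs_density z \<partial>P)"

text \<open>
  The constant \<open>ln partition_fn\<close> in \<open>log_gibbs_density\<close> drops out because \<open>exp log_gibbs_density - 1\<close> has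
  integral zero. What remains is linear in the energy, hence a sum over arcs that depends on the Gibbs
  measure only through its marginals on the arcs.
\<close>

lemma jeffreys_divergence_eq:
  "jeffreys_divergence = (\<Sum>(i, j)\<in>E. \<integral>z. (exp (log_gibbs_density z) - 1) * h (z i) (z j) \<partial>P)"
proof -
  let ?w = "\<lambda>z. exp (log_gibbs_density z) - 1"
  have w_bound: "\<bar>?w z\<bar> \<le> exp (card E * C) + 1" if "z \<in> space P" for z
    using abs_log_gibbs_density_le[OF that] by (simp add: abs_le_iff) (smt (verit) exp_gt_zero exp_le_cancel_iff)
  have w_int: "integrable P ?w"
    using w_bound by (intro P.integrable_bounded) auto
  have wh_int: "integrable P (\<lambda>z. ?w z * h (z i) (z j))" if "(i, j) \<in> E" for i j
  proof (rule P.integrable_bounded)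
    fix z assume z: "z \<in> space P"
    have "\<bar>h (z i) (z j)\<bar> \<le> C"
      using that z P_space arc_in_V h_bounds[of "z i" "z j"] by (auto simp: abs_if)
    thus "\<bar>?w z * h (z i) (z j)\<bar> \<le> (exp (card E * C) + 1) * C"
      unfolding abs_mult using w_bound[OF z] by (intro mult_mono) auto
  qed (use that arc_in_V in auto)
  have "(\<integral>z. ?w z \<partial>P) = 0"
    using integral_gibbs w_int partition_fn_pos
    by (subst Bochner_Integration.integral_diff)
      (auto simp: exp_log_gibbs_density integrable_exp_energy P.prob_space)
  hence 0: "(\<integral>z. ?w z * ln partition_fn \<partial>P) = 0" by simp
  have "jeffreys_divergence = (\<integral>z. (\<Sum>e\<in>E. ?w z * h (z (fst e)) (z (snd e))) - ?w z * ln partition_fn \<partial>P)"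
    unfolding jeffreys_divergence_def
  proof (intro Bochner_Integration.integral_cong refl)
    fix z
    have "?w z * log_gibbs_density z = ?w z * energy z - ?w z * ln partition_fn"
      unfolding log_gibbs_density_def[of z] by (rule right_diff_distrib)
    thus "?w z * log_gibbs_density z = (\<Sum>e\<in>E. ?w z * h (z (fst e)) (z (snd e))) - ?w z * ln partition_fn"
      by (simp only: energy_def case_prod_beta sum_distrib_left)
  qed
  also have "\<dots> = (\<integral>z. (\<Sum>e\<in>E. ?w z * h (z (fst e)) (z (snd e))) \<partial>P) - (\<integral>z. ?w z * ln partition_fn \<partial>P)"
    using wh_int w_int by (intro Bochner_Integration.integral_diff) auto
  also have "\<dots> = (\<Sum>e\<in>E. \<integral>z. ?w z * h (z (fst e)) (z (snd e)) \<partial>P)"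
    using wh_int by (simp only: 0, subst Bochner_Integration.integral_sum) auto
  finally show ?thesis by (simp add: case_prod_beta)
qed

lemma integral_log_gibbs_density_sq_le:
  "(\<integral>z. (log_gibbs_density z)\<^sup>2 \<partial>P) \<le> (1 + card E * C) * jeffreys_divergence"
proof -
  have int: "integrable P (\<lambda>z. (exp (log_gibbs_density z) - 1) * log_gibbs_density z)"
  proof (rule P.integrable_bounded)
    fix z assume z: "z \<in> space P"
    have "\<bar>exp (log_gibbs_density z) - 1\<bar> \<le> exp (card E * C) + 1"
      using abs_log_gibbs_density_le[OF z] by (simp add: abs_le_iff) (smt (verit) exp_gt_zero exp_le_cancel_iff)
    thus "\<bar>(exp (log_gibbs_density z) - 1) * log_gibbs_density z\<bar> \<le> (exp (card E * C) + 1) * (card E * C)"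
      unfolding abs_mult using abs_log_gibbs_density_le[OF z] by (intro mult_mono) (auto simp: C_nonneg)
  qed auto
  have "(\<integral>z. (log_gibbs_density z)\<^sup>2 \<partial>P)
      \<le> (\<integral>z. (1 + card E * C) * ((exp (log_gibbs_density z) - 1) * log_gibbs_density z) \<partial>P)"
    using int abs_log_gibbs_density_le by (intro integral_mono square_le_exp_minus_one_mult) auto
  thus ?thesis by (simp add: jeffreys_divergence_def)
qed

text \<open>
  The Hoeffding decomposition of the potential splits \<open>h x y\<close> into its mean, the two one-variable
  functions \<open>h_out x - h_mean\<close> and \<open>h_in y - h_mean\<close>, and the remainder \<open>interaction x y\<close>, which has integral
  zero in each variable separately. A vertex of a balanced digraph is equally often tail and head, so
  only the sum of the two one-variable functions, \<open>main_effect\<close>, is seen by the energy.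
\<close>

definition h_mean :: real where "h_mean = (\<integral>x. (\<integral>y. h x y \<partial>M) \<partial>M)"
definition h_out :: "'a \<Rightarrow> real" where "h_out x = (\<integral>y. h x y \<partial>M)"
definition h_in :: "'a \<Rightarrow> real" where "h_in y = (\<integral>x. h x y \<partial>M)"
definition main_effect :: "'a \<Rightarrow> real" where
  "main_effect x = h_out x + h_in x - 2 * h_mean"
definition interaction :: "'a \<Rightarrow> 'a \<Rightarrow> real" where
  "interaction x y = h x y - h_out x - h_in y + h_mean"

lemma h_out_measurable [measurable]: "h_out \<in> borel_measurable M"
  unfolding h_out_def by measurable

lemma h_in_measurable [measurable]: "h_in \<in> borel_measurable M"
  unfolding h_in_def by measurable

lemma main_effect_measurable [measurable]: "main_effect \<in> borel_measurable M"
  unfolding main_effect_def by measurable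

lemma interaction_measurable [measurable (raw)]:
  assumes [measurable]: "f \<in> N \<rightarrow>\<^sub>M M" "g \<in> N \<rightarrow>\<^sub>M M"
  shows "(\<lambda>x. interaction (f x) (g x)) \<in> borel_measurable N"
  unfolding interaction_def by measurable

lemma abs_h_le: "x \<in> space M \<Longrightarrow> y \<in> space M \<Longrightarrow> \<bar>h x y\<bar> \<le> C"
  using h_bounds[of x y] by (auto simp: abs_if)

lemma abs_h_out_le: "x \<in> space M \<Longrightarrow> \<bar>h_out x\<bar> \<le> C"
  unfolding h_out_def by (intro abs_integral_le abs_h_le)

lemma abs_h_in_le: "x \<in> space M \<Longrightarrow> \<bar>h_in x\<bar> \<le> C"
  unfolding h_in_def by (intro abs_integral_le abs_h_le)

lemma abs_h_mean_le: "\<bar>h_mean\<bar> \<le> C"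
  unfolding h_mean_def by (intro abs_integral_le abs_h_le)

lemma h_mean_eq: "h_mean = (\<integral>x. h_out x \<partial>M)" "h_mean = (\<integral>y. h_in y \<partial>M)"
proof -
  interpret MM: pair_prob_space M M ..
  show "h_mean = (\<integral>x. h_out x \<partial>M)" by (simp add: h_mean_def h_out_def)
  have "integrable (M \<Otimes>\<^sub>M M) (case_prod h)"
    using abs_h_le h_measurable by (intro MM.P.integrable_bounded[of _ C]) (auto simp: space_pair_measure)
  from MM.Fubini_integral[OF this] show "h_mean = (\<integral>y. h_in y \<partial>M)"
    by (simp add: h_mean_def h_in_def)
qed

lemma abs_main_effect_le: "x \<in> space M \<Longrightarrow> \<bar>main_effect x\<bar> \<le> 4 * C"
  using abs_h_out_le[of x] abs_h_in_le[of x] abs_h_mean_le unfolding main_effect_def by linarith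

lemma abs_interaction_le: "x \<in> space M \<Longrightarrow> y \<in> space M \<Longrightarrow> \<bar>interaction x y\<bar> \<le> 4 * C"
  using abs_h_le[of x y] abs_h_out_le[of x] abs_h_in_le[of y] abs_h_mean_le
  unfolding interaction_def by linarith

lemma integrable_h:
  "integrable M h_out" "integrable M h_in"
  "x \<in> space M \<Longrightarrow> integrable M (\<lambda>y. h x y)" "x \<in> space M \<Longrightarrow> integrable M (\<lambda>y. h y x)"
  using abs_h_le abs_h_out_le abs_h_in_le by (auto intro!: integrable_bounded[of _ C])

lemma integral_main_effect: "(\<integral>x. main_effect x \<partial>M) = 0"
  unfolding main_effect_def using integrable_h by (simp add: h_mean_eq[symmetric] prob_space)

lemma integral_interaction:
  assumes "x \<in> space M"
  shows "(\<integral>y. interaction x y \<partial>M) = 0" "(\<integral>y. interaction y x \<partial>M) = 0"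
  unfolding interaction_def using integrable_h assms
  by (simp_all add: h_mean_eq[symmetric] prob_space flip: h_out_def h_in_def)

text \<open>
  Two different arcs of an oriented graph differ as unordered pairs. Hence one endpoint of \<open>(i, j)\<close> is
  not an endpoint of \<open>(a, b)\<close>, and integrating over its label gives zero. For the same arc the remaining
  parts of the Hoeffding decomposition of \<open>h\<close> depend on one label only.
\<close>

lemma integral_interaction_mult_h:
  assumes ij: "(i, j) \<in> E" and ab: "(a, b) \<in> E"
  shows "(\<integral>z. interaction (z i) (z j) * h (z a) (z b) \<partial>P)
    = (if (a, b) = (i, j) then (\<integral>z. (interaction (z i) (z j))\<^sup>2 \<partial>P) else 0)"
proof -
  have V: "i \<in> V" "j \<in> V" "a \<in> V" "b \<in> V" "i \<noteq> j" "a \<noteq> b" using assms arc_in_V no_loop by auto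
  have bnd: "\<bar>interaction (z i) (z j)\<bar> \<le> 4 * C" if "z \<in> space P" for z
    using that V P_space by (intro abs_interaction_le) auto
  have int: "integrable P (\<lambda>z. interaction (z i) (z j) * g z)"
    if "g \<in> borel_measurable P" "\<And>z. z \<in> space P \<Longrightarrow> \<bar>g z\<bar> \<le> B" for g and B :: real
  proof (rule P.integrable_bounded)
    fix z assume "z \<in> space P"
    thus "\<bar>interaction (z i) (z j) * g z\<bar> \<le> (4 * C) * B"
      unfolding abs_mult using bnd that C_nonneg by (intro mult_mono) auto
  qed (use that V in auto)
  have int_h: "integrable P (\<lambda>z. interaction (z i) (z j) * h (z a) (z b))"
    using V P_space by (intro int[of _ C] abs_h_le) auto
  show ?thesis
  proof (cases "(a, b) = (i, j)")
    case False
    have "i \<notin> {a, b} \<or> j \<notin> {a, b}"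
      using False E_asym assms by auto
    thus ?thesis
    proof
      assume *: "i \<notin> {a, b}"
      have "(\<integral>z. interaction (z i) (z j) * h (z a) (z b) \<partial>P) = 0"
        using finite_V V(1) int_h by (rule integral_power_space_slice_zero) (use V * in \<open>auto simp: integral_interaction\<close>)
      thus ?thesis using False by auto
    next
      assume *: "j \<notin> {a, b}"
      have "(\<integral>z. interaction (z i) (z j) * h (z a) (z b) \<partial>P) = 0"
        using finite_V V(2) int_h by (rule integral_power_space_slice_zero) (use V * in \<open>auto simp: integral_interaction\<close>)
      thus ?thesis using False by auto
    qed
  next
    case True
    have int1: "integrable P (\<lambda>z. interaction (z i) (z j) * (h_out (z i) - h_mean))"
    proof (rule int[of _ "2 * C"])
      show "\<bar>h_out (z i) - h_mean\<bar> \<le> 2 * C" if "z \<in> space P" for z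
        using abs_h_out_le[of "z i"] abs_h_mean_le that V P_space by fastforce
    qed (use V in measurable)
    have int2: "integrable P (\<lambda>z. interaction (z i) (z j) * h_in (z j))"
      using V P_space by (intro int[of _ C] abs_h_in_le) auto
    have int3: "integrable P (\<lambda>z. interaction (z i) (z j) * interaction (z i) (z j))"
      using V bnd by (intro int[of _ "4 * C"]) auto
    have z1: "(\<integral>z. interaction (z i) (z j) * (h_out (z i) - h_mean) \<partial>P) = 0"
      using finite_V V(2) int1 by (rule integral_power_space_slice_zero) (use V in \<open>auto simp: integral_interaction\<close>)
    have z2: "(\<integral>z. interaction (z i) (z j) * h_in (z j) \<partial>P) = 0"
      using finite_V V(1) int2 by (rule integral_power_space_slice_zero) (use V in \<open>auto simp: integral_interaction\<close>)
    have "(\<integral>z. interaction (z i) (z j) * h (z i) (z j) \<partial>P)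
        = (\<integral>z. interaction (z i) (z j) * interaction (z i) (z j)
             + interaction (z i) (z j) * (h_out (z i) - h_mean) + interaction (z i) (z j) * h_in (z j) \<partial>P)"
      by (intro Bochner_Integration.integral_cong refl) (simp add: interaction_def algebra_simps)
    also have "\<dots> = (\<integral>z. (interaction (z i) (z j))\<^sup>2 \<partial>P)"
      using int1 int2 int3 z1 z2 by (simp add: power2_eq_square)
    finally show ?thesis using True by simp
  qed
qed

lemma integral_interaction_mult_log_gibbs_density:
  assumes ij: "(i, j) \<in> E"
  shows "(\<integral>z. interaction (z i) (z j) * log_gibbs_density z \<partial>P) = (\<integral>z. (interaction (z i) (z j))\<^sup>2 \<partial>P)"
proof -
  have V: "i \<in> V" "j \<in> V" "i \<noteq> j" using assms arc_in_V no_loop by auto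
  have bnd: "\<bar>interaction (z i) (z j)\<bar> \<le> 4 * C" if "z \<in> space P" for z
    using that V P_space by (intro abs_interaction_le) auto
  have int0: "integrable P (\<lambda>z. interaction (z i) (z j))"
    using V bnd by (intro P.integrable_bounded) auto
  have int: "integrable P (\<lambda>z. interaction (z i) (z j) * h (z (fst e)) (z (snd e)))" if "e \<in> E" for e
  proof (rule P.integrable_bounded)
    fix z assume z: "z \<in> space P"
    show "\<bar>interaction (z i) (z j) * h (z (fst e)) (z (snd e))\<bar> \<le> (4 * C) * C"
      unfolding abs_mult using bnd[OF z] that P_space[OF z] arc_in_V[of "fst e" "snd e"]
      by (intro mult_mono abs_h_le) auto
  qed (use that V arc_in_V[of "fst e" "snd e"] in auto)
  have zero: "(\<integral>z. interaction (z i) (z j) \<partial>P) = 0"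
    using finite_V V(1) int0 by (rule integral_power_space_slice_zero) (use V in \<open>auto simp: integral_interaction\<close>)
  have "(\<integral>z. interaction (z i) (z j) * log_gibbs_density z \<partial>P)
      = (\<integral>z. (\<Sum>e\<in>E. interaction (z i) (z j) * h (z (fst e)) (z (snd e)))
            - ln partition_fn * interaction (z i) (z j) \<partial>P)"
    by (intro Bochner_Integration.integral_cong refl)
      (simp add: log_gibbs_density_def energy_def case_prod_beta sum_distrib_left algebra_simps)
  also have "\<dots> = (\<Sum>e\<in>E. \<integral>z. interaction (z i) (z j) * h (z (fst e)) (z (snd e)) \<partial>P)"
    using int int0 zero by simp
  also have "\<dots> = (\<Sum>e\<in>E. if e = (i, j) then (\<integral>z. (interaction (z i) (z j))\<^sup>2 \<partial>P) else 0)"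
    using ij integral_interaction_mult_h[OF ij] by (intro sum.cong refl) (auto simp: split_beta)
  also have "\<dots> = (\<integral>z. (interaction (z i) (z j))\<^sup>2 \<partial>P)"
    using ij finite_E by simp
  finally show ?thesis .
qed

text \<open>
  An arc that avoids \<open>i\<close> contributes nothing since \<open>main_effect\<close> has mean zero. For an arc at \<open>i\<close>, averaging
  over the label of its other endpoint replaces \<open>h\<close> by \<open>h_out\<close> or \<open>h_in\<close>.
\<close>

lemma integral_main_effect_mult_h:
  assumes i: "i \<in> V" and ab: "(a, b) \<in> E"
  shows "(\<integral>z. main_effect (z i) * h (z a) (z b) \<partial>P)
    = (if a = i then (\<integral>x. main_effect x * h_out x \<partial>M) else 0)
      + (if b = i then (\<integral>x. main_effect x * h_in x \<partial>M) else 0)"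
proof -
  have V: "i \<in> V" "a \<in> V" "b \<in> V" "a \<noteq> b" using assms arc_in_V no_loop by auto
  have bnd: "\<bar>main_effect (z i)\<bar> \<le> 4 * C" if "z \<in> space P" for z
    using that V P_space by (intro abs_main_effect_le) auto
  have int: "integrable P (\<lambda>z. main_effect (z i) * g z)"
    if "g \<in> borel_measurable P" "\<And>z. z \<in> space P \<Longrightarrow> \<bar>g z\<bar> \<le> B" for g and B :: real
  proof (rule P.integrable_bounded)
    fix z assume "z \<in> space P"
    thus "\<bar>main_effect (z i) * g z\<bar> \<le> (4 * C) * B"
      unfolding abs_mult using bnd that C_nonneg by (intro mult_mono) auto
  qed (use that V in auto)
  have int_h: "integrable P (\<lambda>z. main_effect (z i) * h (z a) (z b))"
    using V P_space by (intro int[of _ C] abs_h_le) auto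
  have int_out: "integrable P (\<lambda>z. main_effect (z i) * h_out (z i))"
    using V P_space by (intro int[of _ C] abs_h_out_le) auto
  have int_in: "integrable P (\<lambda>z. main_effect (z i) * h_in (z i))"
    using V P_space by (intro int[of _ C] abs_h_in_le) auto
  consider "a = i" | "b = i" | "i \<notin> {a, b}" by blast
  thus ?thesis
  proof cases
    case 1
    have "integrable P (\<lambda>z. main_effect (z i) * h (z a) (z b) - main_effect (z i) * h_out (z i))"
      using int_h int_out by simp
    hence "(\<integral>z. main_effect (z i) * h (z a) (z b) - main_effect (z i) * h_out (z i) \<partial>P) = 0"
    proof (rule integral_power_space_slice_zero[OF finite_V V(3)])
      fix z :: "'v \<Rightarrow> 'a" assume "\<And>j. j \<in> V - {b} \<Longrightarrow> z j \<in> space M"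
      hence "z i \<in> space M" using 1 V by auto
      thus "(\<integral>x. main_effect ((z(b := x)) i) * h ((z(b := x)) a) ((z(b := x)) b)
           - main_effect ((z(b := x)) i) * h_out ((z(b := x)) i) \<partial>M) = 0"
        using 1 V integrable_h by (simp add: prob_space h_out_def)
    qed
    moreover have "(\<integral>z. main_effect (z i) * h_out (z i) \<partial>P) = (\<integral>x. main_effect x * h_out x \<partial>M)"
      using V by (intro integral_power_space_single) auto
    ultimately show ?thesis using int_h int_out 1 V by auto
  next
    case 2
    have "integrable P (\<lambda>z. main_effect (z i) * h (z a) (z b) - main_effect (z i) * h_in (z i))"
      using int_h int_in by simp
    hence "(\<integral>z. main_effect (z i) * h (z a) (z b) - main_effect (z i) * h_in (z i) \<partial>P) = 0"
    proof (rule integral_power_space_slice_zero[OF finite_V V(2)])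
      fix z :: "'v \<Rightarrow> 'a" assume "\<And>j. j \<in> V - {a} \<Longrightarrow> z j \<in> space M"
      hence "z i \<in> space M" using 2 V by auto
      thus "(\<integral>x. main_effect ((z(a := x)) i) * h ((z(a := x)) a) ((z(a := x)) b)
           - main_effect ((z(a := x)) i) * h_in ((z(a := x)) i) \<partial>M) = 0"
        using 2 V integrable_h by (simp add: prob_space h_in_def)
    qed
    moreover have "(\<integral>z. main_effect (z i) * h_in (z i) \<partial>P) = (\<integral>x. main_effect x * h_in x \<partial>M)"
      using V by (intro integral_power_space_single) auto
    ultimately show ?thesis using int_h int_in 2 V by auto
  next
    case 3
    have "(\<integral>z. main_effect (z i) * h (z a) (z b) \<partial>P) = 0"
      using finite_V V(1) int_h by (rule integral_power_space_slice_zero) (use 3 in \<open>auto simp: integral_main_effect\<close>)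
    thus ?thesis using 3 by auto
  qed
qed

text \<open>
  With equally many incoming and outgoing arcs, the contributions of \<open>h_out\<close> and \<open>h_in\<close> combine to \<open>d\<close>
  copies of \<open>main_effect\<close>, up to a constant that is orthogonal to \<open>main_effect\<close>.
\<close>

lemma integral_main_effect_mult_log_gibbs_density:
  assumes i: "i \<in> V" 
    and out_deg: "card {e \<in> E. fst e = i} = d" and in_deg: "card {e \<in> E. snd e = i} = d"
  shows "(\<integral>z. main_effect (z i) * log_gibbs_density z \<partial>P) = d * (\<integral>z. (main_effect (z i))\<^sup>2 \<partial>P)"
proof -
  have bnd: "\<bar>main_effect (z i)\<bar> \<le> 4 * C" if "z \<in> space P" for z
    using that i P_space by (intro abs_main_effect_le) auto
  have int0: "integrable P (\<lambda>z. main_effect (z i))"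
    using i bnd by (intro P.integrable_bounded) auto
  have int: "integrable P (\<lambda>z. main_effect (z i) * h (z (fst e)) (z (snd e)))" if "e \<in> E" for e
  proof (rule P.integrable_bounded)
    fix z assume z: "z \<in> space P"
    show "\<bar>main_effect (z i) * h (z (fst e)) (z (snd e))\<bar> \<le> (4 * C) * C"
      unfolding abs_mult using bnd[OF z] that P_space[OF z] arc_in_V[of "fst e" "snd e"]
      by (intro mult_mono abs_h_le) auto
  qed (use that i arc_in_V[of "fst e" "snd e"] in auto)
  have mult: "integrable M (\<lambda>x. main_effect x * g x)"
    if "g \<in> borel_measurable M" "\<And>x. x \<in> space M \<Longrightarrow> \<bar>g x\<bar> \<le> B" for g and B :: real
  proof (rule integrable_bounded)
    fix x assume "x \<in> space M"
    thus "\<bar>main_effect x * g x\<bar> \<le> (4 * C) * B"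
      unfolding abs_mult using that C_nonneg by (intro mult_mono abs_main_effect_le) auto
  qed (use that in auto)
  have int_M: "integrable M main_effect"
    using abs_main_effect_le by (intro integrable_bounded) auto
  have zero: "(\<integral>z. main_effect (z i) \<partial>P) = 0"
    using i by (subst integral_power_space_single) (auto simp: integral_main_effect)
  have "(\<integral>z. main_effect (z i) * log_gibbs_density z \<partial>P)
      = (\<integral>z. (\<Sum>e\<in>E. main_effect (z i) * h (z (fst e)) (z (snd e)))
            - ln partition_fn * main_effect (z i) \<partial>P)"
    by (intro Bochner_Integration.integral_cong refl)
      (simp add: log_gibbs_density_def energy_def case_prod_beta sum_distrib_left algebra_simps)
  also have "\<dots> = (\<Sum>e\<in>E. \<integral>z. main_effect (z i) * h (z (fst e)) (z (snd e)) \<partial>P)"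
    using int int0 zero by simp
  also have "\<dots> = (\<Sum>e\<in>E. (if fst e = i then (\<integral>x. main_effect x * h_out x \<partial>M) else 0)
      + (if snd e = i then (\<integral>x. main_effect x * h_in x \<partial>M) else 0))"
    using integral_main_effect_mult_h[OF i] by (intro sum.cong refl) (auto simp: split_beta)
  also have "\<dots> = d * ((\<integral>x. main_effect x * h_out x \<partial>M) + (\<integral>x. main_effect x * h_in x \<partial>M))"
    using finite_E out_deg in_deg
    by (simp add: sum.distrib sum.If_cases Int_def algebra_simps)
  also have "(\<integral>x. main_effect x * h_out x \<partial>M) + (\<integral>x. main_effect x * h_in x \<partial>M)
      = (\<integral>x. (main_effect x)\<^sup>2 + 2 * h_mean * main_effect x \<partial>M)"
    using mult[of h_out C] mult[of h_in C] abs_h_out_le abs_h_in_le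
    by (subst Bochner_Integration.integral_add[symmetric])
      (auto intro!: Bochner_Integration.integral_cong simp: main_effect_def power2_eq_square algebra_simps)
  also have "\<dots> = (\<integral>x. (main_effect x)\<^sup>2 \<partial>M)"
    using mult[of main_effect "4 * C"] abs_main_effect_le int_M
    by (simp add: integral_main_effect power2_eq_square)
  also have "\<dots> = (\<integral>z. (main_effect (z i))\<^sup>2 \<partial>P)"
    using i by (subst integral_power_space_single) auto
  finally show ?thesis .
qed

text \<open>
  A form of Bessel's inequality: expand the integral of \<open>(f - g)\<^sup>2\<close>. The hypotheses say that the
  projection of \<open>g\<close> to the line spanned by \<open>f\<close> is \<open>t * f\<close>.
\<close>

lemma integral_sq_le_of_inner_product:
  fixes f g :: "'b \<Rightarrow> real" and t :: real
  assumes "integrable N (\<lambda>x. (f x)\<^sup>2)" "integrable N (\<lambda>x. (g x)\<^sup>2)" "integrable N (\<lambda>x. f x * g x)"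
    and "(\<integral>x. f x * g x \<partial>N) = t * (\<integral>x. (f x)\<^sup>2 \<partial>N)" "1 \<le> t"
  shows "(\<integral>x. (f x)\<^sup>2 \<partial>N) \<le> (\<integral>x. (g x)\<^sup>2 \<partial>N)"
proof -
  have "0 \<le> (\<integral>x. (f x - g x)\<^sup>2 \<partial>N)" by simp
  also have "(\<integral>x. (f x - g x)\<^sup>2 \<partial>N) = (\<integral>x. (f x)\<^sup>2 + (g x)\<^sup>2 - 2 * (f x * g x) \<partial>N)"
    by (intro Bochner_Integration.integral_cong refl) (simp add: power2_eq_square algebra_simps)
  also have "\<dots> = (\<integral>x. (f x)\<^sup>2 \<partial>N) + (\<integral>x. (g x)\<^sup>2 \<partial>N) - 2 * (t * (\<integral>x. (f x)\<^sup>2 \<partial>N))"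
    using assms by simp
  finally have "2 * (t * (\<integral>x. (f x)\<^sup>2 \<partial>N)) \<le> (\<integral>x. (f x)\<^sup>2 \<partial>N) + (\<integral>x. (g x)\<^sup>2 \<partial>N)" by simp
  moreover have "1 * (\<integral>x. (f x)\<^sup>2 \<partial>N) \<le> t * (\<integral>x. (f x)\<^sup>2 \<partial>N)"
    using assms by (intro mult_right_mono) auto
  ultimately show ?thesis by simp
qed

text \<open>
  The interaction of an arc is the projection of \<open>log_gibbs_density\<close> to a subspace, so its second moment
  is at most that of \<open>log_gibbs_density\<close>, which is controlled by the divergence.
\<close>

lemma integral_abs_interaction_le:
  assumes "(i, j) \<in> E"
  shows "(\<integral>z. \<bar>interaction (z i) (z j)\<bar> \<partial>P) \<le> sqrt ((1 + card E * C) * jeffreys_divergence)"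
proof -
  have V: "i \<in> V" "j \<in> V" using assms arc_in_V by auto
  have bnd: "\<bar>interaction (z i) (z j)\<bar> \<le> 4 * C" if "z \<in> space P" for z
    using that V P_space by (intro abs_interaction_le) auto
  have int1: "integrable P (\<lambda>z. interaction (z i) (z j))"
    using V bnd by (intro P.integrable_bounded[of _ "4 * C"]) auto
  have int2: "integrable P (\<lambda>z. (interaction (z i) (z j))\<^sup>2)"
    using V bnd by (intro P.integrable_bounded_sq[of _ "4 * C"]) auto
  have int3: "integrable P (\<lambda>z. interaction (z i) (z j) * log_gibbs_density z)"
    using V bnd abs_log_gibbs_density_le
    by (intro P.integrable_bounded[of _ "(4 * C) * (card E * C)"])
      (auto simp: abs_mult C_nonneg intro!: mult_mono)
  have "(\<integral>z. \<bar>interaction (z i) (z j)\<bar> \<partial>P) \<le> sqrt (\<integral>z. (interaction (z i) (z j))\<^sup>2 \<partial>P)"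
    using int1 int2 by (rule P.integral_abs_le_sqrt)
  also have "\<dots> \<le> sqrt (\<integral>z. (log_gibbs_density z)\<^sup>2 \<partial>P)"
    using int2 int3 integral_interaction_mult_log_gibbs_density[OF assms]
    by (intro real_sqrt_le_mono integral_sq_le_of_inner_product[where t = 1]) auto
  also have "\<dots> \<le> sqrt ((1 + card E * C) * jeffreys_divergence)"
    by (intro real_sqrt_le_mono integral_log_gibbs_density_sq_le)
  finally show ?thesis .
qed

lemma integral_abs_main_effect_le:
  assumes i: "i \<in> V" 
    and out_deg: "card {e \<in> E. fst e = i} = d" and in_deg: "card {e \<in> E. snd e = i} = d"
    and d: "d \<ge> 1"
  shows "(\<integral>z. \<bar>main_effect (z i)\<bar> \<partial>P) \<le> sqrt ((1 + card E * C) * jeffreys_divergence)"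
proof -
  have bnd: "\<bar>main_effect (z i)\<bar> \<le> 4 * C" if "z \<in> space P" for z
    using that i P_space by (intro abs_main_effect_le) auto
  have int1: "integrable P (\<lambda>z. main_effect (z i))"
    using i bnd by (intro P.integrable_bounded[of _ "4 * C"]) auto
  have int2: "integrable P (\<lambda>z. (main_effect (z i))\<^sup>2)"
    using i bnd by (intro P.integrable_bounded_sq[of _ "4 * C"]) auto
  have int3: "integrable P (\<lambda>z. main_effect (z i) * log_gibbs_density z)"
    using i bnd abs_log_gibbs_density_le
    by (intro P.integrable_bounded[of _ "(4 * C) * (card E * C)"])
      (auto simp: abs_mult C_nonneg intro!: mult_mono)
  have "(\<integral>z. \<bar>main_effect (z i)\<bar> \<partial>P) \<le> sqrt (\<integral>z. (main_effect (z i))\<^sup>2 \<partial>P)"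
    using int1 int2 by (rule P.integral_abs_le_sqrt)
  also have "\<dots> \<le> sqrt (\<integral>z. (log_gibbs_density z)\<^sup>2 \<partial>P)"
    using int2 int3 integral_main_effect_mult_log_gibbs_density[OF i out_deg in_deg] d
    by (intro real_sqrt_le_mono integral_sq_le_of_inner_product[where t = "real d"]) auto
  also have "\<dots> \<le> sqrt ((1 + card E * C) * jeffreys_divergence)"
    by (intro real_sqrt_le_mono integral_log_gibbs_density_sq_le)
  finally show ?thesis .
qed

end

context pair_potential
begin

text \<open>
  The density of the joint distribution of the labels of \<open>i\<close> and \<open>j\<close> under the Gibbs measure.
\<close>

definition gibbs_marginal :: "'v \<Rightarrow> 'v \<Rightarrow> 'a \<Rightarrow> 'a \<Rightarrow> real" where
  "gibbs_marginal i j x y =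
     (\<integral>z. exp (energy (z(i := x, j := y))) \<partial>power_space (V - {i, j})) / partition_fn"

lemma gibbs_marginal_measurable:
  assumes "i \<in> V" "j \<in> V" "i \<noteq> j"
  shows "case_prod (gibbs_marginal i j) \<in> borel_measurable (M \<Otimes>\<^sub>M M)"
proof -
  interpret R: prob_space "power_space (V - {i, j})" by (rule prob_space_power_space)
  have [measurable]: "(\<lambda>p. (snd p)(i := fst (fst p), j := snd (fst p)))
      \<in> (M \<Otimes>\<^sub>M M) \<Otimes>\<^sub>M power_space (V - {i, j}) \<rightarrow>\<^sub>M P"
    using assms by (rule measurable_update_pair)
  have "(\<lambda>p. exp (energy ((snd p)(i := fst (fst p), j := snd (fst p)))))
      \<in> borel_measurable ((M \<Otimes>\<^sub>M M) \<Otimes>\<^sub>M power_space (V - {i, j}))"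
    by measurable
  hence "(\<lambda>q. \<integral>z. exp (energy (z(i := fst q, j := snd q))) \<partial>power_space (V - {i, j}))
      \<in> borel_measurable (M \<Otimes>\<^sub>M M)"
    by (intro R.borel_measurable_lebesgue_integral) (simp add: case_prod_beta)
  hence "(\<lambda>q. (\<integral>z. exp (energy (z(i := fst q, j := snd q))) \<partial>power_space (V - {i, j})) / partition_fn)
      \<in> borel_measurable (M \<Otimes>\<^sub>M M)"
    by simp
  thus ?thesis by (simp only: case_prod_unfold gibbs_marginal_def)
qed

lemma update_pair_in_P:
  assumes "i \<in> V" "j \<in> V" "x \<in> space M" "y \<in> space M" "z \<in> space (power_space (V - {i, j}))"
  shows "z(i := x, j := y) \<in> space P"
  using assms by (auto simp: space_PiM PiE_iff extensional_def)

lemma abs_gibbs_marginal_le: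
  assumes "i \<in> V" "j \<in> V" "x \<in> space M" "y \<in> space M"
  shows "\<bar>gibbs_marginal i j x y\<bar> \<le> 1 / partition_fn"
proof -
  interpret R: prob_space "power_space (V - {i, j})" by (rule prob_space_power_space)
  have "\<bar>\<integral>z. exp (energy (z(i := x, j := y))) \<partial>power_space (V - {i, j})\<bar> \<le> 1"
    using energy_bounds update_pair_in_P[OF assms] by (intro R.abs_integral_le) auto
  thus ?thesis using partition_fn_pos by (simp add: gibbs_marginal_def divide_right_mono)
qed

lemma integral_gibbs_mult_h:
  assumes "(i, j) \<in> E"
  shows "(\<integral>z. (exp (log_gibbs_density z) - 1) * h (z i) (z j) \<partial>P)
    = (\<integral>(x, y). (gibbs_marginal i j x y - 1) * h x y \<partial>(M \<Otimes>\<^sub>M M))"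
proof -
  have V: "i \<in> V" "j \<in> V" "i \<noteq> j" using assms arc_in_V no_loop by auto
  interpret R: prob_space "power_space (V - {i, j})" by (rule prob_space_power_space)
  have bound: "\<bar>(exp (log_gibbs_density z) - 1) * h (z i) (z j)\<bar> \<le> (1 / partition_fn + 1) * C"
    if z: "z \<in> space P" for z
  proof -
    have "exp (log_gibbs_density z) \<le> 1 / partition_fn"
      using energy_bounds[OF z] partition_fn_pos by (simp add: exp_log_gibbs_density divide_right_mono)
    hence "\<bar>exp (log_gibbs_density z) - 1\<bar> \<le> 1 / partition_fn + 1"
      using exp_gt_zero[of "log_gibbs_density z"] by linarith
    thus ?thesis unfolding abs_mult using V P_space[OF z] by (intro mult_mono abs_h_le) auto
  qed
  have "(\<integral>z. (exp (log_gibbs_density z) - 1) * h (z i) (z j) \<partial>P)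
      = (\<integral>(x, y). (\<integral>z. (exp (log_gibbs_density (z(i := x, j := y))) - 1) * h x y
          \<partial>power_space (V - {i, j})) \<partial>(M \<Otimes>\<^sub>M M))"
    using V by (subst integral_power_space_disintegrate[OF finite_V V _ bound]) auto
  also have "\<dots> = (\<integral>(x, y). (gibbs_marginal i j x y - 1) * h x y \<partial>(M \<Otimes>\<^sub>M M))"
  proof (rule Bochner_Integration.integral_cong[OF refl])
    fix q assume "q \<in> space (M \<Otimes>\<^sub>M M)"
    then obtain x y where q: "q = (x, y)" and xy: "x \<in> space M" "y \<in> space M"
      by (auto simp: space_pair_measure)
    have [measurable]: "(\<lambda>z. z(i := x, j := y)) \<in> power_space (V - {i, j}) \<rightarrow>\<^sub>M P"
      using measurable_compose[OF measurable_Pair1'[of "(x, y)" "M \<Otimes>\<^sub>M M"] measurable_update_pair[OF V]] xy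
      by (simp add: space_pair_measure)
    have int: "integrable (power_space (V - {i, j})) (\<lambda>z. exp (energy (z(i := x, j := y))))"
      using energy_bounds update_pair_in_P[OF V(1,2) xy] by (intro R.integrable_bounded[of _ 1]) auto
    have "(\<integral>z. exp (log_gibbs_density (z(i := x, j := y))) - 1 \<partial>power_space (V - {i, j})) = gibbs_marginal i j x y - 1"
      using int by (simp add: exp_log_gibbs_density gibbs_marginal_def R.prob_space)
    thus "(case q of (x, y) \<Rightarrow>
          \<integral>z. (exp (log_gibbs_density (z(i := x, j := y))) - 1) * h x y \<partial>power_space (V - {i, j}))
        = (case q of (x, y) \<Rightarrow> (gibbs_marginal i j x y - 1) * h x y)"
      by (simp add: q)
  qed
  finally show ?thesis .
qed

text \<open>
  Each arc contributes the integral of \<open>h\<close> against \<open>gibbs_marginal - 1\<close>, and \<open>\<bar>h\<bar> \<le> C\<close>.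
\<close>

lemma jeffreys_divergence_le:
  "jeffreys_divergence \<le> C * (\<Sum>(i, j)\<in>E. \<integral>(x, y). \<bar>gibbs_marginal i j x y - 1\<bar> \<partial>(M \<Otimes>\<^sub>M M))"
proof -
  interpret MM: pair_prob_space M M ..
  have "(\<integral>z. (exp (log_gibbs_density z) - 1) * h (z i) (z j) \<partial>P)
      \<le> C * (\<integral>(x, y). \<bar>gibbs_marginal i j x y - 1\<bar> \<partial>(M \<Otimes>\<^sub>M M))" if ij: "(i, j) \<in> E" for i j
  proof -
    have V: "i \<in> V" "j \<in> V" "i \<noteq> j" using ij arc_in_V no_loop by auto
    note [measurable] = gibbs_marginal_measurable[OF V]
    have le: "\<bar>gibbs_marginal i j x y - 1\<bar> \<le> 1 / partition_fn + 1" if "x \<in> space M" "y \<in> space M" for x y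
      using abs_gibbs_marginal_le[OF V(1,2) that] by linarith
    have int: "integrable (M \<Otimes>\<^sub>M M) (\<lambda>(x, y). C * \<bar>gibbs_marginal i j x y - 1\<bar>)"
      using le C_nonneg
      by (intro MM.P.integrable_bounded[of _ "C * (1 / partition_fn + 1)"])
        (auto simp: space_pair_measure abs_mult intro!: mult_left_mono)
    have le': "(gibbs_marginal i j x y - 1) * h x y \<le> C * \<bar>gibbs_marginal i j x y - 1\<bar>"
      if "x \<in> space M" "y \<in> space M" for x y
    proof -
      have "(gibbs_marginal i j x y - 1) * h x y \<le> \<bar>gibbs_marginal i j x y - 1\<bar> * \<bar>h x y\<bar>"
        by (metis abs_ge_self abs_mult)
      also have "\<dots> \<le> \<bar>gibbs_marginal i j x y - 1\<bar> * C"
        using that by (intro mult_left_mono abs_h_le) auto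
      finally show ?thesis by (simp add: mult.commute)
    qed
    have "integrable (M \<Otimes>\<^sub>M M) (\<lambda>(x, y). (gibbs_marginal i j x y - 1) * h x y)"
      using le C_nonneg abs_h_le h_measurable partition_fn_pos
      by (intro MM.P.integrable_bounded[of _ "(1 / partition_fn + 1) * C"])
        (auto simp: space_pair_measure abs_mult intro!: mult_mono)
    hence "(\<integral>(x, y). (gibbs_marginal i j x y - 1) * h x y \<partial>(M \<Otimes>\<^sub>M M))
        \<le> (\<integral>(x, y). C * \<bar>gibbs_marginal i j x y - 1\<bar> \<partial>(M \<Otimes>\<^sub>M M))"
      using int le' by (intro integral_mono) (auto simp: space_pair_measure)
    thus ?thesis
      by (simp only: integral_gibbs_mult_h[OF ij] case_prod_unfold integral_mult_right_zero)
  qed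
  thus ?thesis
    unfolding jeffreys_divergence_eq sum_distrib_left by (intro sum_mono) auto
qed

end

section \<open>Tournament kernels\<close>

text \<open>
  The hypotheses hold pointwise on \<open>space M\<close>, so that \<open>ln W\<close> is a pair potential; kernels that satisfy them
  almost everywhere are first modified on a null set.
\<close>

locale balanced_kernel = prob_space M for M :: "'a measure" +
  fixes V :: "'v set" and E :: "('v \<times> 'v) set" and W :: "'a \<Rightarrow> 'a \<Rightarrow> real" and \<alpha> :: real
  assumes fin: "finite V"
    and sub: "E \<subseteq> V \<times> V"
    and asym: "(i, j) \<in> E \<Longrightarrow> (j, i) \<notin> E"
    and balanced: "i \<in> V \<Longrightarrow> card {e \<in> E. snd e = i} = card {e \<in> E. fst e = i}"
    and nonempty: "E \<noteq> {}"
    and W_measurable [measurable]: "case_prod W \<in> borel_measurable (M \<Otimes>\<^sub>M M)"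
    and \<alpha>_pos: "0 < \<alpha>"
    and W_ge: "\<And>x y. x \<in> space M \<Longrightarrow> y \<in> space M \<Longrightarrow> \<alpha> \<le> W x y"
    and W_sum: "\<And>x y. x \<in> space M \<Longrightarrow> y \<in> space M \<Longrightarrow> W x y + W y x = 1"
begin

lemma W_bounds:
  assumes "x \<in> space M" "y \<in> space M"
  shows "0 < W x y" "W x y < 1"
  using W_ge[of x y] W_ge[of y x] W_sum[of x y] assms \<alpha>_pos by linarith+

sublocale pair_potential M V E "\<lambda>x y. ln (W x y)" "ln (1 / \<alpha>)"
proof
  fix x y assume xy: "x \<in> space M" "y \<in> space M"
  have "ln \<alpha> \<le> ln (W x y)" using W_ge[OF xy] \<alpha>_pos by simp
  thus "ln (W x y) \<in> {- ln (1 / \<alpha>)..0}"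
    using W_bounds[OF xy] \<alpha>_pos by (simp add: ln_div)
qed (use fin sub asym in auto)

lemma exp_energy:
  assumes "z \<in> space P"
  shows "exp (energy z) = (\<Prod>(i, j)\<in>E. W (z i) (z j))"
proof -
  have "exp (energy z) = (\<Prod>e\<in>E. exp (ln (W (z (fst e)) (z (snd e)))))"
    by (simp add: energy_def case_prod_beta exp_sum[OF finite_E])
  also have "\<dots> = (\<Prod>(i, j)\<in>E. W (z i) (z j))"
    using assms arc_in_V by (intro prod.cong refl) (auto intro!: exp_ln W_bounds(1) P_space)
  finally show ?thesis .
qed

text \<open>
  The mean of \<open>log_cosh\<close> of the log-odds of \<open>W x y\<close>, which is \<open>- (ln 4 + ln (W x y) + ln (W y x))\<close>.
\<close>

definition mean_log_cosh :: real where
  "mean_log_cosh = - (ln 4 + 2 * h_mean)"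

text \<open>
  The function \<open>ln (W x y) + ln (W y x)\<close> is symmetric in \<open>x\<close> and \<open>y\<close>, so both one-variable parts of its
  Hoeffding decomposition are the main effect.
\<close>

lemma log_cosh_near_mean:
  assumes "x \<in> space M" "y \<in> space M"
  shows "\<bar>log_cosh (ln (W x y) - ln (W y x)) - mean_log_cosh\<bar>
    \<le> \<bar>main_effect x\<bar> + \<bar>main_effect y\<bar> + \<bar>interaction x y\<bar> + \<bar>interaction y x\<bar>"
proof -
  have "1 - W x y = W y x" using W_sum[OF assms] by simp
  hence "log_cosh (ln (W x y) - ln (W y x)) = - (ln 4 + ln (W x y) + ln (W y x))"
    using log_cosh_ln_odds[of "W x y"] W_bounds[OF assms] by simp
  hence "log_cosh (ln (W x y) - ln (W y x)) - mean_log_cosh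
      = - (main_effect x + main_effect y + interaction x y + interaction y x)"
    by (simp add: mean_log_cosh_def main_effect_def interaction_def)
  thus ?thesis by linarith
qed

text \<open>
  In the cyclic sum of the log-odds \<open>ln (W x y) - ln (W y x)\<close> over a triangle all one-variable parts
  cancel; only interactions are left. Hence \<open>log_cosh_cyclic\<close> applies with small errors.
\<close>

lemma mean_log_cosh_le_triple:
  assumes x: "x \<in> space M" and y: "y \<in> space M" and z: "z \<in> space M"
  shows "mean_log_cosh \<le> 2 * (\<bar>main_effect x\<bar> + \<bar>main_effect y\<bar> + \<bar>main_effect z\<bar>)
    + 2 * (\<bar>interaction x y\<bar> + \<bar>interaction y x\<bar> + \<bar>interaction y z\<bar>
         + \<bar>interaction z y\<bar> + \<bar>interaction z x\<bar> + \<bar>interaction x z\<bar>)"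
proof -
  define u where "u = (\<lambda>x y. ln (W x y) - ln (W y x))"
  have "u x y + u y z + u z x = interaction x y - interaction y x + interaction y z
      - interaction z y + interaction z x - interaction x z"
    by (simp add: u_def interaction_def)
  hence "\<bar>u x y + u y z + u z x\<bar> \<le> \<bar>interaction x y\<bar> + \<bar>interaction y x\<bar> + \<bar>interaction y z\<bar>
      + \<bar>interaction z y\<bar> + \<bar>interaction z x\<bar> + \<bar>interaction x z\<bar>"
    by linarith
  moreover have near: "\<bar>log_cosh (u x y) - mean_log_cosh\<bar>
      \<le> \<bar>main_effect x\<bar> + \<bar>main_effect y\<bar> + \<bar>interaction x y\<bar> + \<bar>interaction y x\<bar>"
    if "x \<in> space M" "y \<in> space M" for x y
    using log_cosh_near_mean[OF that] by (simp add: u_def)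
  have "q \<le> s + a + b + c \<Longrightarrow> s \<le> s' \<Longrightarrow> a \<le> a' \<Longrightarrow> b \<le> b' \<Longrightarrow> c \<le> c'
      \<Longrightarrow> q \<le> s' + a' + b' + c'" for q s a b c s' a' b' c' :: real
    by linarith
  note this[OF log_cosh_cyclic[of mean_log_cosh "u x y" "u y z" "u z x"] _
      near[OF x y] near[OF y z] near[OF z x]]
  ultimately have "mean_log_cosh \<le> (\<bar>interaction x y\<bar> + \<bar>interaction y x\<bar> + \<bar>interaction y z\<bar>
      + \<bar>interaction z y\<bar> + \<bar>interaction z x\<bar> + \<bar>interaction x z\<bar>)
    + (\<bar>main_effect x\<bar> + \<bar>main_effect y\<bar> + \<bar>interaction x y\<bar> + \<bar>interaction y x\<bar>)
    + (\<bar>main_effect y\<bar> + \<bar>main_effect z\<bar> + \<bar>interaction y z\<bar> + \<bar>interaction z y\<bar>)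
    + (\<bar>main_effect z\<bar> + \<bar>main_effect x\<bar> + \<bar>interaction z x\<bar> + \<bar>interaction x z\<bar>)"
    by blast
  thus ?thesis by (simp add: algebra_simps)
qed

lemma ex_directed_path: 
  obtains i j l where "(i, j) \<in> E" "(j, l) \<in> E" "i \<noteq> l"
proof -
  obtain i j where ij: "(i, j) \<in> E" using nonempty by auto
  hence "(i, j) \<in> {e \<in> E. snd e = j}" by simp
  hence "card {e \<in> E. snd e = j} \<noteq> 0" using finite_E by (auto simp: card_eq_0_iff)
  hence "{e \<in> E. fst e = j} \<noteq> {}" using balanced[of j] arc_in_V[OF ij] by force
  then obtain l where "(j, l) \<in> E" by auto
  thus thesis using that ij asym by blast
qed

text \<open>
  Integrating the pointwise bound over three independent labels gives \<open>6 + 12\<close> error terms. Their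
  integrals do not depend on the choice of distinct vertices, so each is bounded by means of the arc
  \<open>(i, j)\<close>, whatever the orientation of the other two pairs. The third vertex \<open>l\<close> comes from the balance
  condition at \<open>j\<close>.
\<close>

lemma mean_log_cosh_le: "mean_log_cosh \<le> 18 * sqrt ((1 + card E * ln (1 / \<alpha>)) * jeffreys_divergence)"
proof -
  obtain i j l where E: "(i, j) \<in> E" "(j, l) \<in> E" "i \<noteq> l" by (rule ex_directed_path)
  have V: "i \<in> V" "j \<in> V" "l \<in> V" and ne: "i \<noteq> j" "j \<noteq> l" using E arc_in_V no_loop by auto
  let ?B = "sqrt ((1 + card E * ln (1 / \<alpha>)) * jeffreys_divergence)"
  let ?K = "\<lambda>a b. \<integral>z. \<bar>interaction (z a) (z b)\<bar> \<partial>P"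
  let ?F = "\<lambda>a. \<integral>z. \<bar>main_effect (z a)\<bar> \<partial>P"
  have deg: "card {e \<in> E. fst e = i} \<ge> 1"
    using E(1) finite_E by (simp add: Suc_le_eq card_gt_0_iff) force
  have F: "?F a \<le> ?B" if "a \<in> V" for a
  proof -
    have "?F a = ?F i" using that V
      by (simp add: integral_power_space_single[where g = "\<lambda>x. \<bar>main_effect x\<bar>"])
    also have "\<dots> \<le> ?B"
      using V(1) refl balanced[OF V(1)] deg by (rule integral_abs_main_effect_le)
    finally show ?thesis .
  qed
  have K: "?K a b \<le> ?B" if "a \<in> V" "b \<in> V" "a \<noteq> b" for a b
  proof -
    have "?K a b = ?K i j"
      using that V ne
      by (simp add: integral_power_space_pair[where g = "\<lambda>x y. \<bar>interaction x y\<bar>"])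
    also have "\<dots> \<le> ?B" using E(1) by (rule integral_abs_interaction_le)
    finally show ?thesis .
  qed
  have intF: "integrable P (\<lambda>z. \<bar>main_effect (z a)\<bar>)" if "a \<in> V" for a
    using that P_space abs_main_effect_le by (intro P.integrable_bounded[of _ "4 * ln (1 / \<alpha>)"]) auto
  have intK: "integrable P (\<lambda>z. \<bar>interaction (z a) (z b)\<bar>)" if "a \<in> V" "b \<in> V" for a b
    using that P_space abs_interaction_le by (intro P.integrable_bounded[of _ "4 * ln (1 / \<alpha>)"]) auto
  have "mean_log_cosh = (\<integral>z. mean_log_cosh \<partial>P)" by (simp add: P.prob_space)
  also have "\<dots> \<le> (\<integral>z. 2 * (\<bar>main_effect (z i)\<bar> + \<bar>main_effect (z j)\<bar> + \<bar>main_effect (z l)\<bar>)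
    + 2 * (\<bar>interaction (z i) (z j)\<bar> + \<bar>interaction (z j) (z i)\<bar> + \<bar>interaction (z j) (z l)\<bar>
         + \<bar>interaction (z l) (z j)\<bar> + \<bar>interaction (z l) (z i)\<bar> + \<bar>interaction (z i) (z l)\<bar>) \<partial>P)"
    using V intF intK P_space by (intro integral_mono mean_log_cosh_le_triple) auto
  also have "\<dots> = 2 * (?F i + ?F j + ?F l) + 2 * (?K i j + ?K j i + ?K j l + ?K l j + ?K l i + ?K i l)"
    using V intF intK by simp
  also have "\<dots> \<le> 2 * (?B + ?B + ?B) + 2 * (?B + ?B + ?B + ?B + ?B + ?B)"
    using V ne E(3) by (intro add_mono mult_left_mono F K) auto
  also have "\<dots> = 18 * ?B" by simp
  finally show ?thesis .
qed

text \<open>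
  By \<open>ln t \<le> t - 1\<close> the square \<open>(W x y - 1/2)\<^sup>2\<close> is at most a quarter of \<open>log_cosh\<close> of the log-odds.
\<close>

theorem integral_square_minus_half_le:
  "(\<integral>(x, y). (W x y - 1 / 2)\<^sup>2 \<partial>(M \<Otimes>\<^sub>M M))
    \<le> 9 / 2 * sqrt ((1 + card E * ln (1 / \<alpha>)) * jeffreys_divergence)"
proof -
  interpret MM: pair_prob_space M M ..
  have int: "integrable (M \<Otimes>\<^sub>M M) (\<lambda>(x, y). ln (W x y))" "integrable (M \<Otimes>\<^sub>M M) (\<lambda>(x, y). ln (W y x))"
    using abs_h_le by (auto intro!: MM.P.integrable_bounded[of _ "ln (1 / \<alpha>)"] simp: space_pair_measure)
  have mean: "(\<integral>(x, y). ln (W x y) \<partial>(M \<Otimes>\<^sub>M M)) = h_mean" "(\<integral>(x, y). ln (W y x) \<partial>(M \<Otimes>\<^sub>M M)) = h_mean"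
    using MM.integral_fst[OF int(1)] MM.integral_snd[OF int(2)] by (simp_all add: h_mean_def)
  have "(\<integral>(x, y). (W x y - 1 / 2)\<^sup>2 \<partial>(M \<Otimes>\<^sub>M M))
      \<le> (\<integral>p. - (ln 4 + (case p of (x, y) \<Rightarrow> ln (W x y)) + (case p of (x, y) \<Rightarrow> ln (W y x))) / 4 \<partial>(M \<Otimes>\<^sub>M M))"
  proof (rule integral_mono)
    show "integrable (M \<Otimes>\<^sub>M M) (\<lambda>(x, y). (W x y - 1 / 2)\<^sup>2)"
    proof -
      have "\<bar>W x y - 1 / 2\<bar> \<le> 1" if "x \<in> space M" "y \<in> space M" for x y
        using W_bounds[OF that] by linarith
      thus ?thesis
        using MM.P.integrable_bounded_sq[of "\<lambda>(x, y). W x y - 1 / 2" 1]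
        by (auto simp: space_pair_measure case_prod_unfold)
    qed
    show "integrable (M \<Otimes>\<^sub>M M) (\<lambda>p. - (ln 4 + (case p of (x, y) \<Rightarrow> ln (W x y)) + (case p of (x, y) \<Rightarrow> ln (W y x))) / 4)"
      using int by simp
    fix p assume "p \<in> space (M \<Otimes>\<^sub>M M)"
    then obtain x y where p: "p = (x, y)" "x \<in> space M" "y \<in> space M" by (auto simp: space_pair_measure)
    have "1 - W x y = W y x" using W_sum[of x y] p by simp
    thus "(case p of (x, y) \<Rightarrow> (W x y - 1 / 2)\<^sup>2)
        \<le> - (ln 4 + (case p of (x, y) \<Rightarrow> ln (W x y)) + (case p of (x, y) \<Rightarrow> ln (W y x))) / 4"
      using p square_minus_half_le_ln[of "W x y"] W_bounds[of x y] by simp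
  qed
  also have "\<dots> = mean_log_cosh / 4"
    using int mean by (simp add: MM.P.prob_space mean_log_cosh_def)
  also have "\<dots> \<le> 9 / 2 * sqrt ((1 + card E * ln (1 / \<alpha>)) * jeffreys_divergence)"
    using mean_log_cosh_le by simp
  finally show ?thesis .
qed

end

section \<open>Kernels up to null sets\<close>

text \<open>
  Over a complete measure a function inherits measurability from one that agrees with it almost
  everywhere. This matters for the integrands of the densities, which are formed from a Lebesgue
  measurable kernel and in general are measurable only with respect to the completed product.
\<close>

lemma (in complete_measure) measurable_cong_AE_complete:
  fixes f g :: "'a \<Rightarrow> 'b::topological_space"
  assumes g: "g \<in> borel_measurable M" and eq: "AE x in M. f x = g x"
  shows "f \<in> borel_measurable M"
proof (rule measurableI)
  fix A :: "'b set" assume "A \<in> sets borel"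
  with g have meas: "g -` A \<inter> space M \<in> sets M" by (rule measurable_sets)
  have ae: "AE x in M. x \<in> g -` A \<inter> space M \<longleftrightarrow> x \<in> f -` A \<inter> space M"
    using eq by (rule eventually_mono) simp
  show "f -` A \<inter> space M \<in> sets M"
    using ae meas Int_lower2 by (rule in_sets_AE)
qed simp

lemma (in complete_measure) integral_cong_AE_complete:
  fixes f g :: "'a \<Rightarrow> real"
  assumes "g \<in> borel_measurable M" "AE x in M. f x = g x"
  shows "(\<integral>x. f x \<partial>M) = (\<integral>x. g x \<partial>M)"
  using measurable_cong_AE_complete[OF assms] assms by (intro integral_cong_AE) auto

lemma integral_completion_cong_AE:
  fixes f g :: "'a \<Rightarrow> real"
  assumes "g \<in> borel_measurable M" "AE x in M. f x = g x"
  shows "(\<integral>x. f x \<partial>completion M) = (\<integral>x. g x \<partial>M)"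
proof -
  have "(\<integral>x. f x \<partial>completion M) = (\<integral>x. g x \<partial>completion M)"
    using assms by (intro completion.integral_cong_AE_complete measurable_completion AE_completion)
  thus ?thesis using assms by (simp add: integral_completion)
qed

context balanced_kernel
begin

lemma AE_arc_product_eq:
  assumes eq: "AE (x, y) in M \<Otimes>\<^sub>M M. U x y = W x y"
  shows "AE z in P. (\<Prod>(a, b)\<in>E. U (z a) (z b)) = exp (energy z)"
proof -
  have "AE z in P. U (z (fst e)) (z (snd e)) = W (z (fst e)) (z (snd e))" if "e \<in> E" for e
  proof -
    have V: "fst e \<in> V" "snd e \<in> V" "fst e \<noteq> snd e"
      using that arc_in_V[of "fst e" "snd e"] no_loop[of "fst e"] by (auto simp: prod_eq_iff) (metis prod.collapse)
    have "AE p in distr P (M \<Otimes>\<^sub>M M) (\<lambda>z. (z (fst e), z (snd e))). (case p of (x, y) \<Rightarrow> U x y = W x y)"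
      unfolding distr_power_space_pair[OF V] by (rule eq)
    from AE_distrD[OF _ this] V show ?thesis by simp
  qed
  hence "AE z in P. \<forall>e\<in>E. U (z (fst e)) (z (snd e)) = W (z (fst e)) (z (snd e))"
    using finite_E by (intro AE_finite_allI)
  moreover have "AE z in P. z \<in> space P" by simp
  ultimately show ?thesis
  proof eventually_elim
    case (elim z)
    thus ?case by (auto simp: exp_energy case_prod_unfold intro!: prod.cong)
  qed
qed

lemma integral_completion_arc_product:
  assumes eq: "AE (x, y) in M \<Otimes>\<^sub>M M. U x y = W x y"
  shows "(\<integral>z. (\<Prod>(a, b)\<in>E. U (z a) (z b)) \<partial>completion P) = partition_fn"
  unfolding partition_fn_def using AE_arc_product_eq[OF eq]
  by (intro integral_completion_cong_AE) auto

text \<open>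
  Almost every labelling of all vertices lies outside the exceptional set of \<open>U\<close>. By independence of the
  two root labels from the rest and Fubini, for almost every choice of the root labels this remains
  true of almost every labelling of the other vertices.
\<close>

lemma AE_rooted_density_eq:
  assumes eq: "AE (x, y) in M \<Otimes>\<^sub>M M. U x y = W x y" and ij: "(i, j) \<in> E"
  shows "AE (x, y) in M \<Otimes>\<^sub>M M.
    (\<integral>z. (\<Prod>(a, b)\<in>E. U ((z(i := x, j := y)) a) ((z(i := x, j := y)) b)) \<partial>completion (power_space (V - {i, j})))
      / partition_fn = gibbs_marginal i j x y"
proof -
  let ?J = "V - {i, j}"
  let ?u = "\<lambda>p. (snd p)(i := fst (fst p), j := snd (fst p))"
  have V: "i \<in> V" "j \<in> V" "i \<noteq> j" using ij arc_in_V no_loop by auto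
  interpret R: prob_space "power_space ?J" by (rule prob_space_power_space)
  interpret MM: pair_prob_space M M ..
  interpret MMR: pair_prob_space "M \<Otimes>\<^sub>M M" "power_space ?J" ..
  note upd = measurable_update_pair[OF V]
  have "AE z in distr ((M \<Otimes>\<^sub>M M) \<Otimes>\<^sub>M power_space ?J) P ?u.
      (\<Prod>(a, b)\<in>E. U (z a) (z b)) = exp (energy z)"
    using AE_arc_product_eq[OF eq] by (simp only: distr_update_pair[OF finite_V V])
  hence "AE p in (M \<Otimes>\<^sub>M M) \<Otimes>\<^sub>M power_space ?J.
      (\<Prod>(a, b)\<in>E. U (?u p a) (?u p b)) = exp (energy (?u p))"
    by (rule AE_distrD[OF upd])
  hence "AE q in M \<Otimes>\<^sub>M M. AE z in power_space ?J.
      (\<Prod>(a, b)\<in>E. U (?u (q, z) a) (?u (q, z) b)) = exp (energy (?u (q, z)))"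
    by (rule MMR.AE_pair)
  moreover have "AE q in M \<Otimes>\<^sub>M M. q \<in> space (M \<Otimes>\<^sub>M M)" by simp
  ultimately show ?thesis
  proof eventually_elim
    case (elim q)
    have "(\<lambda>z. ?u (q, z)) \<in> power_space ?J \<rightarrow>\<^sub>M P"
      using measurable_compose[OF measurable_Pair1'[OF elim(2)] upd] .
    hence "(\<lambda>z. exp (energy (?u (q, z)))) \<in> borel_measurable (power_space ?J)"
      by measurable
    from integral_completion_cong_AE[OF this elim(1)] show ?case
      by (simp only: gibbs_marginal_def case_prod_unfold fst_conv snd_conv)
  qed
qed

end

section \<open>Lebesgue measure on the unit square\<close>

abbreviation unit_interval :: "real measure" where
  "unit_interval \<equiv> lebesgue_on {0..1}"

lemma prob_space_unit_interval: "prob_space unit_interval"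
  by (rule prob_spaceI) (simp add: emeasure_restrict_space)

interpretation unit_interval: prob_space unit_interval
  by (rule prob_space_unit_interval)

interpretation unit_interval_pair: pair_prob_space unit_interval unit_interval ..

lemma sets_unit_square [simp]: "{0..1} \<times> {0..1} \<in> sets (lebesgue :: (real \<times> real) measure)"
  by (intro sets_completionI_sets) (simp add: borel_closed closed_Times)

lemma space_unit_square [simp]: "space unit_square = {0..1} \<times> {0..1}"
  by (simp add: unit_square_def)

text \<open>
  Completeness passes to a measurable subspace, since null sets there are null sets of the whole space.
\<close>

lemma complete_measure_lebesgue_on:
  fixes S :: "'a::euclidean_space set"
  assumes "S \<in> sets lebesgue"
  shows "complete_measure (lebesgue_on S)"
proof
  fix A B :: "'a set" assume *: "B \<subseteq> A" "A \<in> null_sets (lebesgue_on S)"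
  hence "A \<subseteq> S" "A \<in> null_sets lebesgue"
    using assms by (auto simp: null_sets_restrict_space)
  thus "B \<in> sets (lebesgue_on S)"
    using * assms completion.complete[of B A lborel] by (auto simp: sets_restrict_space_iff)
qed

lemma null_sets_lborel_Times_UNIV:
  fixes N :: "real set"
  assumes "N \<in> null_sets lborel"
  shows "N \<times> UNIV \<in> null_sets (lborel :: (real \<times> real) measure)"
    and "UNIV \<times> N \<in> null_sets (lborel :: (real \<times> real) measure)"
proof -
  have "N \<times> (UNIV :: real set) \<in> null_sets (lborel \<Otimes>\<^sub>M lborel)"
       "(UNIV :: real set) \<times> N \<in> null_sets (lborel \<Otimes>\<^sub>M lborel)"
    using assms by (auto simp: null_sets_def lborel.emeasure_pair_measure_Times)
  thus "N \<times> UNIV \<in> null_sets (lborel :: (real \<times> real) measure)"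
    "UNIV \<times> N \<in> null_sets (lborel :: (real \<times> real) measure)"
    by (simp_all add: lborel_prod)
qed

text \<open>
  The projections are measurable even with respect to the completed measure on the line, since the
  preimage of a null set is a null strip.
\<close>

lemma measurable_lebesgue_fst_snd:
  "fst \<in> (lebesgue :: (real \<times> real) measure) \<rightarrow>\<^sub>M lebesgue"
  "snd \<in> (lebesgue :: (real \<times> real) measure) \<rightarrow>\<^sub>M lebesgue"
proof -
  have b: "fst \<in> (lebesgue :: (real \<times> real) measure) \<rightarrow>\<^sub>M lborel"
       "snd \<in> (lebesgue :: (real \<times> real) measure) \<rightarrow>\<^sub>M lborel"
    by (intro measurable_completion; simp add: borel_prod[symmetric])+
  have "fst -` N \<inter> space lebesgue = N \<times> (UNIV :: real set)"
       "snd -` N \<inter> space lebesgue = (UNIV :: real set) \<times> N" for N :: "real set"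
    by auto
  hence "N \<in> null_sets (distr lebesgue lborel (fst :: real \<times> real \<Rightarrow> real))"
        "N \<in> null_sets (distr lebesgue lborel (snd :: real \<times> real \<Rightarrow> real))" if "N \<in> null_sets lborel" for N
    using null_sets_lborel_Times_UNIV[OF that] that b
    by (auto simp: null_sets_distr_iff intro!: null_sets_completionI)
  thus "fst \<in> (lebesgue :: (real \<times> real) measure) \<rightarrow>\<^sub>M lebesgue"
       "snd \<in> (lebesgue :: (real \<times> real) measure) \<rightarrow>\<^sub>M lebesgue"
    using b by (auto intro!: completion.measurable_completion2)
qed

lemma measurable_unit_square_id: "(\<lambda>p. p) \<in> unit_square \<rightarrow>\<^sub>M unit_interval \<Otimes>\<^sub>M unit_interval"
proof -
  have "(\<lambda>p. (fst p, snd p)) \<in> unit_square \<rightarrow>\<^sub>M unit_interval \<Otimes>\<^sub>M unit_interval"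
    unfolding unit_square_def
    by (intro measurable_Pair measurable_restrict_space3 measurable_lebesgue_fst_snd) auto
  thus ?thesis by simp
qed

text \<open>
  Replacing both factors by Borel sets that agree with them up to null sets changes the product only by
  two null strips.
\<close>

lemma emeasure_lebesgue_Times:
  fixes A B :: "real set"
  assumes A: "A \<in> sets lebesgue" and B: "B \<in> sets lebesgue"
  shows "A \<times> B \<in> sets lebesgue" "emeasure lebesgue (A \<times> B) = emeasure lebesgue A * emeasure lebesgue B"
proof -
  have "A \<times> B = (fst -` A \<inter> space lebesgue) \<inter> (snd -` B \<inter> space lebesgue)" by auto
  also have "\<dots> \<in> sets lebesgue"
    using A B by (intro sets.Int measurable_sets[OF measurable_lebesgue_fst_snd(1)] measurable_sets[OF measurable_lebesgue_fst_snd(2)])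
  finally show AB: "A \<times> B \<in> sets lebesgue" .
  let ?A = "main_part lborel A" and ?B = "main_part lborel B"
  have m: "?A \<in> sets lborel" "?B \<in> sets lborel" using A B by (blast intro: main_part_sets)+
  have AB': "?A \<times> ?B \<in> sets (lborel \<Otimes>\<^sub>M lborel)" using m by (rule pair_measureI)
  have ae: "AE x in lborel. x \<in> S \<longleftrightarrow> x \<in> main_part lborel S" if "S \<in> sets lebesgue" for S :: "real set"
    using AE_notin_null_part[OF that] main_part_null_part_Un[OF that] by (auto elim!: eventually_mono)
  have lift: "AE p in (lborel :: (real \<times> real) measure). Q (fst p) \<and> Q' (snd p)"
    if "AE x in lborel. Q x" "AE x in lborel. Q' x" for Q Q' :: "real \<Rightarrow> bool"
  proof -
    have "\<exists>N\<in>null_sets lborel. {x \<in> space lborel. \<not> Q x} \<subseteq> N"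
      using that(1) by (simp only: eventually_ae_filter)
    then obtain N where N: "N \<in> null_sets lborel" "{x \<in> space lborel. \<not> Q x} \<subseteq> N"
      by (rule bexE)
    have "\<exists>N\<in>null_sets lborel. {x \<in> space lborel. \<not> Q' x} \<subseteq> N"
      using that(2) by (simp only: eventually_ae_filter)
    then obtain N' where N': "N' \<in> null_sets lborel" "{x \<in> space lborel. \<not> Q' x} \<subseteq> N'"
      by (rule bexE)
    have "N \<times> UNIV \<union> UNIV \<times> N' \<in> null_sets (lborel :: (real \<times> real) measure)"
      using N(1) N'(1) by (intro null_sets.Un null_sets_lborel_Times_UNIV)
    thus ?thesis by (rule AE_I') (use N(2) N'(2) in auto)
  qed
  have "emeasure lebesgue (A \<times> B) = emeasure lebesgue (?A \<times> ?B)"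
  proof (rule emeasure_eq_AE)
    show "AE p in lebesgue. p \<in> A \<times> B \<longleftrightarrow> p \<in> ?A \<times> ?B"
      using AE_completion[OF lift[OF ae[OF A] ae[OF B]]]
      by (rule eventually_mono) (simp add: mem_Times_iff)
    show "?A \<times> ?B \<in> sets lebesgue"
      using AB' by (intro sets_completionI_sets) (simp only: lborel_prod)
  qed (rule AB)
  also have "\<dots> = emeasure (lborel \<Otimes>\<^sub>M lborel) (?A \<times> ?B)"
  proof -
    have "?A \<times> ?B \<in> sets lborel" using AB' by (simp only: lborel_prod)
    thus ?thesis by (simp only: lborel_prod emeasure_completion[OF sets_completionI_sets] main_part)
  qed
  also have "\<dots> = emeasure lborel ?A * emeasure lborel ?B"
    using m by (rule lborel.emeasure_pair_measure_Times)
  also have "\<dots> = emeasure lebesgue A * emeasure lebesgue B"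
    using A B by simp
  finally show "emeasure lebesgue (A \<times> B) = emeasure lebesgue A * emeasure lebesgue B" .
qed

text \<open>
  Lebesgue measure on the square extends the product of the Lebesgue measures on its sides to a larger
  sigma-algebra.
\<close>

lemma distr_unit_square: "distr unit_square (unit_interval \<Otimes>\<^sub>M unit_interval) (\<lambda>p. p) = unit_interval \<Otimes>\<^sub>M unit_interval"
proof (rule pair_measure_eqI[symmetric])
  fix A B assume AB: "A \<in> sets unit_interval" "B \<in> sets unit_interval"
  hence s: "A \<subseteq> {0..1}" "B \<subseteq> {0..1}" and l: "A \<in> sets lebesgue" "B \<in> sets lebesgue"
    by (auto simp: sets_restrict_space_iff)
  have "emeasure (distr unit_square (unit_interval \<Otimes>\<^sub>M unit_interval) (\<lambda>p. p)) (A \<times> B)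
      = emeasure unit_square (A \<times> B)"
    using AB s by (subst emeasure_distr[OF measurable_unit_square_id]) (auto intro!: arg_cong[where f = "emeasure unit_square"])
  also have "\<dots> = emeasure lebesgue (A \<times> B)"
    unfolding unit_square_def using s by (intro emeasure_restrict_space) auto
  also have "\<dots> = emeasure unit_interval A * emeasure unit_interval B"
    using s by (simp only: emeasure_lebesgue_Times(2)[OF l]) (subst (1 2) emeasure_restrict_space, auto)
  finally show "emeasure unit_interval A * emeasure unit_interval B
     = emeasure (distr unit_square (unit_interval \<Otimes>\<^sub>M unit_interval) (\<lambda>p. p)) (A \<times> B)" by simp
qed (use unit_interval.sigma_finite_measure_axioms in auto)

text \<open>
  The larger sigma-algebra contributes no essentially new null sets: each is covered by a Borel null
  set, and the Borel sets belong to the product sigma-algebra.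
\<close>

lemma AE_unit_square_iff:
  "(AE p in unit_square. Q p) \<longleftrightarrow> (AE p in unit_interval \<Otimes>\<^sub>M unit_interval. Q p)"
proof
  assume "AE p in unit_interval \<Otimes>\<^sub>M unit_interval. Q p"
  hence "AE p in distr unit_square (unit_interval \<Otimes>\<^sub>M unit_interval) (\<lambda>p. p). Q p"
    by (simp only: distr_unit_square)
  thus "AE p in unit_square. Q p" by (rule AE_distrD[OF measurable_unit_square_id])
next
  assume "AE p in unit_square. Q p"
  hence "AE p in lborel. p \<in> {0..1} \<times> {0..1} \<longrightarrow> Q p"
    unfolding unit_square_def by (simp add: AE_restrict_space_iff AE_completion_iff)
  hence "\<exists>N\<in>null_sets lborel. {p \<in> space lborel. \<not> (p \<in> {0..1} \<times> {0..1} \<longrightarrow> Q p)} \<subseteq> N"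
    by (simp only: eventually_ae_filter)
  then obtain N where N: "N \<in> null_sets lborel" "{p \<in> space lborel. \<not> (p \<in> {0..1} \<times> {0..1} \<longrightarrow> Q p)} \<subseteq> N"
    by (rule bexE)
  have id: "(\<lambda>p. p) \<in> unit_interval \<Otimes>\<^sub>M unit_interval \<rightarrow>\<^sub>M (borel :: (real \<times> real) measure)"
  proof -
    have "(\<lambda>x. x) \<in> unit_interval \<rightarrow>\<^sub>M borel" 
      by (intro measurable_restrict_space1 measurable_completion) simp
    from measurable_compose[OF measurable_fst this] measurable_compose[OF measurable_snd this]
    have "(\<lambda>p. (fst p, snd p)) \<in> unit_interval \<Otimes>\<^sub>M unit_interval \<rightarrow>\<^sub>M borel \<Otimes>\<^sub>M borel"
      by (intro measurable_Pair)
    thus ?thesis by (simp add: borel_prod)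
  qed
  let ?N = "N \<inter> {0..1} \<times> {0..1}"
  have "N \<in> sets borel" using N by auto
  from measurable_sets[OF id this] have N': "?N \<in> sets (unit_interval \<Otimes>\<^sub>M unit_interval)"
    by (simp add: space_pair_measure)
  have "emeasure (unit_interval \<Otimes>\<^sub>M unit_interval) ?N = emeasure unit_square ?N"
    using N' by (subst distr_unit_square[symmetric], subst emeasure_distr[OF measurable_unit_square_id])
      (auto intro!: arg_cong[where f = "emeasure unit_square"])
  also have "\<dots> = emeasure lebesgue ?N"
    unfolding unit_square_def by (intro emeasure_restrict_space) auto
  also have "\<dots> = 0"
  proof -
    have "?N \<in> null_sets lebesgue"
      using N(1) by (intro null_set_Int2 null_sets_completionI) auto
    thus ?thesis by auto
  qed
  finally have "?N \<in> null_sets (unit_interval \<Otimes>\<^sub>M unit_interval)" using N' by auto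
  thus "AE p in unit_interval \<Otimes>\<^sub>M unit_interval. Q p"
    by (rule AE_I') (use N(2) in \<open>auto simp: space_pair_measure\<close>)
qed

lemma integral_unit_square_cong_AE:
  fixes f g :: "real \<times> real \<Rightarrow> real"
  assumes g: "g \<in> borel_measurable (unit_interval \<Otimes>\<^sub>M unit_interval)"
    and eq: "AE p in unit_interval \<Otimes>\<^sub>M unit_interval. f p = g p"
  shows "(\<integral>p. f p \<partial>unit_square) = (\<integral>p. g p \<partial>(unit_interval \<Otimes>\<^sub>M unit_interval))"
proof -
  interpret complete_measure unit_square
    unfolding unit_square_def by (rule complete_measure_lebesgue_on) simp
  have "(\<integral>p. f p \<partial>unit_square) = (\<integral>p. g p \<partial>unit_square)"
    using measurable_compose[OF measurable_unit_square_id g] eq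
    by (intro integral_cong_AE_complete) (auto simp: AE_unit_square_iff)
  also have "\<dots> = (\<integral>p. g p \<partial>distr unit_square (unit_interval \<Otimes>\<^sub>M unit_interval) (\<lambda>p. p))"
    using measurable_unit_square_id g by (rule integral_distr[symmetric])
  finally show ?thesis by (simp only: distr_unit_square)
qed

text \<open>
  A Borel version of \<open>W\<close> is clipped to \<open>{\<alpha>..1 - \<alpha>}\<close> and then made antisymmetric about \<open>1/2\<close> by averaging
  \<open>W x y\<close> with \<open>1 - W y x\<close>. Almost everywhere neither step changes the value: \<open>W y x = 1 - W x y\<close> and
  \<open>\<alpha> \<le> W y x\<close> imply \<open>W x y \<le> 1 - \<alpha>\<close>.
\<close>

lemma tournamenton_regular_version:
  assumes W: "tournamenton W" and \<alpha>: "0 < \<alpha>"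
    and ge: "AE (x, y) in unit_square. \<alpha> \<le> W x y \<and> W x y \<le> 1"
  obtains W' where "case_prod W' \<in> borel_measurable (unit_interval \<Otimes>\<^sub>M unit_interval)"
    and "\<And>x y. \<alpha> \<le> W' x y" "\<And>x y. W' x y + W' y x = 1"
    and "AE (x, y) in unit_interval \<Otimes>\<^sub>M unit_interval. W x y = W' x y"
proof -
  let ?Q = "unit_interval \<Otimes>\<^sub>M unit_interval"
  have swap: "AE (x, y) in ?Q. R y x" if "AE (x, y) in ?Q. R x y" for R :: "real \<Rightarrow> real \<Rightarrow> bool"
  proof -
    have "AE p in distr ?Q ?Q (\<lambda>(x, y). (y, x)). (case p of (x, y) \<Rightarrow> R x y)"
      using that by (subst unit_interval_pair.distr_pair_swap[symmetric])
    from AE_distrD[OF measurable_pair_swap' this] show ?thesis by (simp add: case_prod_unfold)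
  qed
  have sum: "AE (x, y) in ?Q. W x y + W y x = 1"
    using W by (simp add: tournamenton_def AE_unit_square_iff)
  have ge': "AE (x, y) in ?Q. \<alpha> \<le> W x y"
    using ge by (auto simp: AE_unit_square_iff elim!: eventually_mono)
  obtain g where g: "g \<in> borel_measurable borel" and Wg: "AE (x, y) in ?Q. W x y = g (x, y)"
  proof -
    have "(\<lambda>p. if p \<in> {0..1} \<times> {0..1} then case_prod W p else 0) \<in> borel_measurable lebesgue"
      using W by (subst borel_measurable_if) (simp_all add: tournamenton_def unit_square_def)
    from completion_ex_borel_measurable_real[OF this]
    obtain g where g: "g \<in> borel_measurable lborel"
      "AE p in lborel. (if p \<in> {0..1} \<times> {0..1} then case_prod W p else 0) = g p" by blast
    hence "AE p in unit_square. case_prod W p = g p"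
      unfolding unit_square_def by (auto simp: AE_restrict_space_iff intro!: AE_completion elim!: eventually_mono)
    hence "AE (x, y) in ?Q. W x y = g (x, y)"
      by (simp add: AE_unit_square_iff case_prod_unfold)
    thus thesis using g(1) that by simp
  qed
  \<comment> \<open>The clipping interval is nonempty since \<open>2 * \<alpha> \<le> W x y + W y x = 1\<close> for some \<open>x\<close> and \<open>y\<close>.\<close>
  have \<alpha>_half: "\<alpha> \<le> 1 / 2"
  proof -
    have "AE p in ?Q. \<alpha> \<le> 1 / 2"
      using sum ge' swap[OF ge'] by eventually_elim auto
    thus ?thesis by simp
  qed
  define W0 where "W0 = (\<lambda>x y. max \<alpha> (min (1 - \<alpha>) (g (x, y))))"
  define W' where "W' = (\<lambda>x y. (W0 x y + (1 - W0 y x)) / 2)"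
  have bounds: "\<alpha> \<le> W0 x y" "W0 x y \<le> 1 - \<alpha>" for x y
    using \<alpha>_half by (auto simp: W0_def)
  have id: "(\<lambda>x. x) \<in> unit_interval \<rightarrow>\<^sub>M (borel :: real measure)"
    by (intro measurable_restrict_space1 measurable_completion) simp
  have [measurable]: "(\<lambda>p. g (fst p, snd p)) \<in> borel_measurable ?Q" "(\<lambda>p. g (snd p, fst p)) \<in> borel_measurable ?Q"
  proof -
    have "(\<lambda>p. (fst p, snd p)) \<in> ?Q \<rightarrow>\<^sub>M borel" "(\<lambda>p. (snd p, fst p)) \<in> ?Q \<rightarrow>\<^sub>M borel"
      unfolding borel_prod[symmetric]
      by (intro measurable_Pair measurable_compose[OF measurable_fst id]
          measurable_compose[OF measurable_snd id])+
    thus "(\<lambda>p. g (fst p, snd p)) \<in> borel_measurable ?Q" "(\<lambda>p. g (snd p, fst p)) \<in> borel_measurable ?Q"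
      using g by (auto intro: measurable_compose)
  qed
  show thesis
  proof (rule that)
    show "case_prod W' \<in> borel_measurable ?Q"
      unfolding W'_def W0_def case_prod_unfold by measurable
    show "\<alpha> \<le> W' x y" for x y
      using bounds(1)[of x y] bounds(2)[of y x] by (simp add: W'_def)
    show "W' x y + W' y x = 1" for x y
      by (simp add: W'_def field_simps)
    show "AE (x, y) in ?Q. W x y = W' x y"
      using sum ge' swap[OF ge'] Wg swap[OF Wg]
    proof eventually_elim
      case (elim p)
      thus ?case
        by (cases p) (auto simp: W'_def W0_def max_def min_def)
    qed
  qed
qed

text \<open>
  The second moment of the log-density costs only the factor \<open>1 + m * M\<close>. With \<open>x = m * M\<close> and
  \<open>m \<le> 3 / 2 * x\<close> it remains to compare \<open>3 / 2 * x * (1 + x)\<close> with \<open>2 * exp x + x\<^sup>2\<close>.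
\<close>

lemma linear_le_exponential_factor:
  fixes m M :: real
  assumes "0 < m" "2 / 3 \<le> M"
  shows "(1 + m * M) * M \<le> (2 * exp (m * M) + m\<^sup>2 * M\<^sup>2) * M / m"
proof -
  define x where "x = m * M"
  have x: "0 \<le> x" using assms by (simp add: x_def)
  have "(1 + x / 2)\<^sup>2 \<le> (exp (x / 2))\<^sup>2"
    using x by (intro power_mono exp_ge_add_one_self) auto
  hence e: "1 + x + x\<^sup>2 / 4 \<le> exp x"
    by (simp add: power2_eq_square field_simps flip: exp_add)
  have "m \<le> 3 / 2 * x" using assms by (simp add: x_def)
  hence "m * (1 + x) \<le> 3 / 2 * x * (1 + x)"
    using x by (intro mult_right_mono) auto
  also have "\<dots> \<le> 2 * exp x + x\<^sup>2"
    using e x by (simp add: power2_eq_square algebra_simps)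
  finally have "m * (1 + x) * M \<le> (2 * exp x + x\<^sup>2) * M"
    using assms by (intro mult_right_mono) auto
  thus ?thesis
    using assms by (simp add: x_def power_mult_distrib pos_le_divide_eq mult_ac)
qed

theorem corollary5p5:
  fixes T :: "'v pair_pre_digraph"
    and W :: "real \<Rightarrow> real \<Rightarrow> real"
    and \<alpha> M :: real
    and m :: nat
  assumes "regular_tournament T"
    and "m = card (parcs T)"
    and "m \<ge> 1"
    and "tournamenton W"
    and "0 < \<alpha>"
    and "AE (x, y) in unit_square. \<alpha> \<le> W x y \<and> W x y \<le> 1"
    and "M = ln (1 / \<alpha>)"
  shows "(L2_norm_square (\<lambda>x y. W x y - 1/2))\<^sup>2
    \<le> (8 * (cosh M)\<^sup>2 + M / 8)
       * sqrt ((2 * exp (real m * M) + (real m)\<^sup>2 * M\<^sup>2) * M / real m * rooted_discrepancy T W)"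
proof -
  let ?Q = "unit_interval \<Otimes>\<^sub>M unit_interval"
  interpret T: regular_tournament T by fact
  obtain W' where W': "case_prod W' \<in> borel_measurable ?Q" "\<And>x y. \<alpha> \<le> W' x y" "\<And>x y. W' x y + W' y x = 1"
    and eq: "AE (x, y) in ?Q. W x y = W' x y"
    using tournamenton_regular_version[OF assms(4-6)] by blast
  have "(j, i) \<notin> parcs T" if "(i, j) \<in> parcs T" for i j
    using that T.one_orientation[of i j] T.no_loops'[OF that] T.in_arcsD1[OF that] T.in_arcsD2[OF that] by blast
  moreover have "card {e \<in> parcs T. snd e = i} = card {e \<in> parcs T. fst e = i}" if "i \<in> pverts T" for i
    using T.in_degree_eq_out_degree[OF that]
    by (simp add: in_degree_def out_degree_def in_arcs_def out_arcs_def)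
  moreover have "parcs T \<noteq> {}" using assms(2,3) by auto
  moreover have "parcs T \<subseteq> pverts T \<times> pverts T"
    using T.in_arcsD1 T.in_arcsD2 by auto
  ultimately interpret K: balanced_kernel unit_interval "pverts T" "parcs T" W' \<alpha>
    using W' assms(5) T.pair_finite_verts by unfold_locales auto
  note [measurable] = W'(1)

  have hom: "hom_density T W = K.partition_fn"
    using K.integral_completion_arc_product[OF eq]
    by (simp add: hom_density_def arc_product_def unit_cube_def)
  have L1: "L1_norm_square (\<lambda>x y. normalized_rooted_density T W (i, j) x y - 1)
      = (\<integral>(x, y). \<bar>K.gibbs_marginal i j x y - 1\<bar> \<partial>?Q)" if ij: "(i, j) \<in> parcs T" for i j
  proof -
    have V: "i \<in> pverts T" "j \<in> pverts T" "i \<noteq> j" using ij K.arc_in_V K.no_loop by auto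
    note [measurable] = K.gibbs_marginal_measurable[OF V]
    have "AE (x, y) in ?Q. normalized_rooted_density T W (i, j) x y = K.gibbs_marginal i j x y"
      using K.AE_rooted_density_eq[OF eq ij]
      by (simp add: normalized_rooted_density_def arc_rooted_density_def arc_product_def unit_cube_def hom)
    hence "AE p in ?Q. (case p of (x, y) \<Rightarrow> \<bar>normalized_rooted_density T W (i, j) x y - 1\<bar>)
        = (case p of (x, y) \<Rightarrow> \<bar>K.gibbs_marginal i j x y - 1\<bar>)"
      by (rule eventually_mono) auto
    thus ?thesis
      unfolding L1_norm_square_def by (intro integral_unit_square_cong_AE) auto
  qed
  have disc: "rooted_discrepancy T W = (\<Sum>(i, j)\<in>parcs T. \<integral>(x, y). \<bar>K.gibbs_marginal i j x y - 1\<bar> \<partial>?Q)"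
    unfolding rooted_discrepancy_def using L1 by (intro sum.cong refl) auto
  have disc_nonneg: "0 \<le> rooted_discrepancy T W"
    unfolding disc case_prod_unfold by (intro sum_nonneg Bochner_Integration.integral_nonneg) simp
  have L2: "(L2_norm_square (\<lambda>x y. W x y - 1/2))\<^sup>2 = (\<integral>(x, y). (W' x y - 1 / 2)\<^sup>2 \<partial>?Q)"
  proof -
    have "AE p in ?Q. (case p of (x, y) \<Rightarrow> (W x y - 1 / 2)\<^sup>2) = (case p of (x, y) \<Rightarrow> (W' x y - 1 / 2)\<^sup>2)"
      using eq by (rule eventually_mono) auto
    hence "(\<integral>(x, y). (W x y - 1 / 2)\<^sup>2 \<partial>unit_square) = (\<integral>(x, y). (W' x y - 1 / 2)\<^sup>2 \<partial>?Q)"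
      by (intro integral_unit_square_cong_AE) auto
    moreover have "0 \<le> (\<integral>(x, y). (W x y - 1 / 2)\<^sup>2 \<partial>unit_square)"
      unfolding case_prod_unfold by (intro Bochner_Integration.integral_nonneg) simp
    ultimately show ?thesis by (simp add: L2_norm_square_def)
  qed

  have m: "real m > 0" using assms(3) by simp
  \<comment> \<open>On the diagonal the antisymmetric version has the value \<open>1/2\<close>, whence \<open>\<alpha> \<le> 1/2\<close> and \<open>M \<ge> ln 2\<close>.\<close>
  have M_ge: "2 / 3 \<le> M"
  proof -
    have "\<alpha> \<le> 1 / 2" using W'(2)[of 0 0] W'(3)[of 0 0] by simp
    hence "ln 2 \<le> ln (1 / \<alpha>)" using assms(5) by (simp add: field_simps)
    thus ?thesis using ln2_ge_two_thirds assms(7) by simp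
  qed
  have "(1 + real m * M) * K.jeffreys_divergence \<le> (1 + real m * M) * (M * rooted_discrepancy T W)"
    using K.jeffreys_divergence_le m M_ge assms(7) disc by (intro mult_left_mono) auto
  also have "\<dots> = ((1 + real m * M) * M) * rooted_discrepancy T W" by simp
  also have "\<dots> \<le> (2 * exp (real m * M) + (real m)\<^sup>2 * M\<^sup>2) * M / real m * rooted_discrepancy T W"
    using linear_le_exponential_factor[OF m M_ge] disc_nonneg by (rule mult_right_mono)
  finally have B: "(1 + real m * M) * K.jeffreys_divergence \<le> \<dots>" .
  have "(L2_norm_square (\<lambda>x y. W x y - 1/2))\<^sup>2 \<le> 9 / 2 * sqrt ((1 + real m * M) * K.jeffreys_divergence)"
    using K.integral_square_minus_half_le by (simp add: L2 assms(2,7))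
  also have "\<dots> \<le> 9 / 2 * sqrt ((2 * exp (real m * M) + (real m)\<^sup>2 * M\<^sup>2) * M / real m * rooted_discrepancy T W)"
    using B by simp
  also have "\<dots> \<le> (8 * (cosh M)\<^sup>2 + M / 8)
       * sqrt ((2 * exp (real m * M) + (real m)\<^sup>2 * M\<^sup>2) * M / real m * rooted_discrepancy T W)"
  proof (rule mult_right_mono)
    have "1 \<le> (cosh M)\<^sup>2" using cosh_real_ge_1[of M] by (simp add: one_le_power)
    thus "9 / 2 \<le> 8 * (cosh M)\<^sup>2 + M / 8" using M_ge by linarith
    show "0 \<le> sqrt ((2 * exp (real m * M) + (real m)\<^sup>2 * M\<^sup>2) * M / real m * rooted_discrepancy T W)"
      using disc_nonneg M_ge by (intro real_sqrt_ge_zero mult_nonneg_nonneg divide_nonneg_nonneg) auto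
  qed
  finally show ?thesis .
qed

end
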